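(* Let $d\ge 1$ and $n$ be integers and let $\mathcal{T}_{n,d+1}$ be the set of all trees of order $n$ with maximum degree $d+1$. Then the $(d+1)$-greedy tree $T_{d+1}^*$ is the unique tree in $\mathcal{T}_{n,d+1}$ with minimum Laplacian coefficient generation function: for every $T\in\mathcal{T}_{n,d+1}$ and every $x>0$, $$\varphi(T_{d+1}^*,x)\le \varphi(T,x),$$ with equality if and only if $T=T_{d+1}^*$ (up to isomorphism).
   Context: For a tree $T$ of order $n$ with Laplacian matrix $L(T)=D(T)-A(T)$ (degree diagonal matrix minus adjacency matrix), write its Laplacian characteristic polynomial as $\det(\lambda I_n-L(T))=\sum_{k=0}^n(-1)^k c_k(T)\lambda^{n-k}$. The Laplacian coefficient generation function is $\varphi(T,x)=c_0(T)+c_1(T)x+\dots+c_{n-1}(T)x^{n-1}$. A rooted $d$-ary tree is a rooted tree in which every vertex has $0$ or $d$ children. The complete $d$-ary tree $C_h$ of height $h-1$ is the rooted $d$-ary tree all of whose leaves are at distance $h-1$ from the root ($C_1$ is a single vertex; the root of $C_h$ has $d$ children, each the root of a copy of $C_{h-1}$). For a vertex $u$ of a rooted tree, $T(u)$ denotes the subtree induced by $u$ and all its descendants, rooted at $u$. The $(d+1)$-greedy tree $T_{d+1}^*$ (of order $n$) is a rooted tree with root $v_0$ and maximum degree $d+1$ such that: (1) $\deg(v_0)=d+1$; (2) the heights (distances to $v_0$) of any two pendent vertices differ by at most $1$; (3) for every vertex $v$, at most one of the subtrees $T(u)$, $u$ a child of $v$, is not a complete $d$-ary tree.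
   Formalization: Conditions (1)–(3) do not determine the greedy tree (d=2, n=10: root carrying C_2, C_2 and a 3-vertex path also satisfies them), so the definition also requires that every vertex lying at least two levels above some other vertex has degree d+1. *)

theory Defs
  imports "Jordan_Normal_Form.Char_Poly"
begin

type_synonym 'a ugraph = "'a set \<times> 'a set set"

abbreviation verts :: "'a ugraph \<Rightarrow> 'a set" where
  "verts G \<equiv> fst G"

abbreviation edges :: "'a ugraph \<Rightarrow> 'a set set" where
  "edges G \<equiv> snd G"

definition simple_graph :: "'a ugraph \<Rightarrow> bool" where
  "simple_graph G \<longleftrightarrow> finite (verts G) \<and> (\<forall>e\<in>edges G. e \<subseteq> verts G \<and> card e = 2)"

definition order :: "'a ugraph \<Rightarrow> nat" where
  "order G = card (verts G)"

definition neighbours :: "'a ugraph \<Rightarrow> 'a \<Rightarrow> 'a set" where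
  "neighbours G v = {u \<in> verts G. {u, v} \<in> edges G}"

definition vdegree :: "'a ugraph \<Rightarrow> 'a \<Rightarrow> nat" where
  "vdegree G v = card (neighbours G v)"

definition max_degree :: "'a ugraph \<Rightarrow> nat" where
  "max_degree G = Max (vdegree G ` verts G)"

definition induced :: "'a ugraph \<Rightarrow> 'a set \<Rightarrow> 'a ugraph" where
  "induced G W = (W, {e \<in> edges G. e \<subseteq> W})"

definition graph_iso :: "'a ugraph \<Rightarrow> 'b ugraph \<Rightarrow> bool" where
  "graph_iso G H \<longleftrightarrow> (\<exists>f. bij_betw f (verts G) (verts H) \<and>
     (\<forall>u\<in>verts G. \<forall>v\<in>verts G. {u, v} \<in> edges G \<longleftrightarrow> {f u, f v} \<in> edges H))"

text \<open>Paths are given by their lists of vertices, so a path of length \<open>k\<close> is a list of length \<open>k + 1\<close>.\<close>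

definition graph_path :: "'a ugraph \<Rightarrow> 'a list \<Rightarrow> bool" where
  "graph_path G p \<longleftrightarrow> p \<noteq> [] \<and> distinct p \<and> set p \<subseteq> verts G \<and>
     successively (\<lambda>u v. {u, v} \<in> edges G) p"

definition path_between :: "'a ugraph \<Rightarrow> 'a \<Rightarrow> 'a \<Rightarrow> 'a list \<Rightarrow> bool" where
  "path_between G u v p \<longleftrightarrow> graph_path G p \<and> hd p = u \<and> last p = v"

definition graph_cycle :: "'a ugraph \<Rightarrow> 'a list \<Rightarrow> bool" where
  "graph_cycle G p \<longleftrightarrow> graph_path G p \<and> length p \<ge> 3 \<and> {last p, hd p} \<in> edges G"

definition connected_graph :: "'a ugraph \<Rightarrow> bool" where
  "connected_graph G \<longleftrightarrow> verts G \<noteq> {} \<and>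
     (\<forall>u\<in>verts G. \<forall>v\<in>verts G. \<exists>p. path_between G u v p)"

definition tree :: "'a ugraph \<Rightarrow> bool" where
  "tree G \<longleftrightarrow> simple_graph G \<and> connected_graph G \<and> (\<nexists>p. graph_cycle G p)"

definition gdist :: "'a ugraph \<Rightarrow> 'a \<Rightarrow> 'a \<Rightarrow> nat" where
  "gdist G u v = (LEAST k. \<exists>p. path_between G u v p \<and> length p = Suc k)"

text \<open>A rooted tree is a tree \<open>G\<close> together with a vertex \<open>r\<close>. Every vertex counts as a descendant
  of itself.\<close>

definition descendants :: "'a ugraph \<Rightarrow> 'a \<Rightarrow> 'a \<Rightarrow> 'a set" where
  "descendants G r u = {w. \<exists>p. path_between G r w p \<and> u \<in> set p}"

definition children :: "'a ugraph \<Rightarrow> 'a \<Rightarrow> 'a \<Rightarrow> 'a set" where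
  "children G r v = neighbours G v \<inter> descendants G r v"

definition subtree_at :: "'a ugraph \<Rightarrow> 'a \<Rightarrow> 'a \<Rightarrow> 'a ugraph" where
  "subtree_at G r u = induced G (descendants G r u)"

definition rooted_dary_tree :: "nat \<Rightarrow> 'a ugraph \<Rightarrow> 'a \<Rightarrow> bool" where
  "rooted_dary_tree d G r \<longleftrightarrow> tree G \<and> r \<in> verts G \<and>
     (\<forall>v\<in>verts G. card (children G r v) = 0 \<or> card (children G r v) = d)"

definition complete_dary_tree :: "nat \<Rightarrow> 'a ugraph \<Rightarrow> 'a \<Rightarrow> bool" where
  "complete_dary_tree d G r \<longleftrightarrow> rooted_dary_tree d G r \<and>
     (\<exists>h\<ge>1. \<forall>v\<in>verts G. children G r v = {} \<longrightarrow> gdist G r v = h - 1)"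

text \<open>The first three conditions on the root \<open>r\<close> are the usual description of the greedy tree.
  On their own they also admit trees with an unsaturated inner vertex far above the leaves: for
  \<open>d = 2\<close> they hold for the tree of order 10 whose root carries two copies of \<open>C\<^sub>2\<close> and a path with
  three vertices, although that tree is not isomorphic to the greedy tree of order 10 (in which the
  root carries three copies of \<open>C\<^sub>2\<close>). The last condition makes explicit what ``greedy'' stands for,
  namely that all levels except the last one are completely filled; it determines the tree of a given
  order up to isomorphism.\<close>

definition greedy_rooted_tree :: "nat \<Rightarrow> 'a ugraph \<Rightarrow> 'a \<Rightarrow> bool" where
  "greedy_rooted_tree d G r \<longleftrightarrow> tree G \<and> r \<in> verts G \<and> max_degree G = d + 1 \<and>
     vdegree G r = d + 1 \<and>
     (\<forall>u\<in>verts G. \<forall>v\<in>verts G. vdegree G u = 1 \<and> vdegree G v = 1 \<longrightarrow>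
        gdist G r u \<le> gdist G r v + 1) \<and>
     (\<forall>v\<in>verts G.
        card {u \<in> children G r v. \<not> complete_dary_tree d (subtree_at G r u) u} \<le> 1) \<and>
     (\<forall>v\<in>verts G. \<forall>w\<in>verts G. gdist G r v + 2 \<le> gdist G r w \<longrightarrow> vdegree G v = d + 1)"

definition greedy_tree :: "nat \<Rightarrow> 'a ugraph \<Rightarrow> bool" where
  "greedy_tree d G \<longleftrightarrow> (\<exists>r. greedy_rooted_tree d G r)"

text \<open>Trees of order \<open>n\<close> are taken on the vertex set \<open>{0..<n}\<close>, which also indexes the rows and
  columns of their matrices.\<close>

definition trees_max_degree :: "nat \<Rightarrow> nat \<Rightarrow> nat ugraph set" where
  "trees_max_degree n \<Delta> = {T. tree T \<and> verts T = {0..<n} \<and> max_degree T = \<Delta>}"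

definition degree_matrix :: "nat ugraph \<Rightarrow> real mat" where
  "degree_matrix G = mat (order G) (order G) (\<lambda>(i, j). if i = j then real (vdegree G i) else 0)"

definition adjacency_matrix :: "nat ugraph \<Rightarrow> real mat" where
  "adjacency_matrix G = mat (order G) (order G) (\<lambda>(i, j). if {i, j} \<in> edges G then 1 else 0)"

definition laplacian_matrix :: "nat ugraph \<Rightarrow> real mat" where
  "laplacian_matrix G = degree_matrix G - adjacency_matrix G"

text \<open>Since \<open>det (\<lambda> I - L) = (\<Sum>k\<le>n. (-1)^k c\<^sub>k \<lambda>^(n-k))\<close>, the Laplacian coefficient \<open>c\<^sub>k\<close> is
  \<open>(-1)^k\<close> times the coefficient of \<open>\<lambda>^(n-k)\<close>.\<close>

definition laplacian_coeff :: "nat ugraph \<Rightarrow> nat \<Rightarrow> real" where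
  "laplacian_coeff G k = (-1) ^ k * coeff (char_poly (laplacian_matrix G)) (order G - k)"

definition laplacian_gen :: "nat ugraph \<Rightarrow> real \<Rightarrow> real" where
  "laplacian_gen G x = (\<Sum>k<order G. laplacian_coeff G k * x ^ k)"

end

theory Submission
  imports Defs
begin

text \<open>
  Eliminating leaves computes \<open>\<phi>(T, x) = det (I + x L(T))\<close>. Root \<open>T\<close>, ground every vertex
  by a unit conductance and give every edge conductance \<open>x\<close>; let \<open>\<tau>(v)\<close> be the conductance to
  the ground of the branch at \<open>v\<close>. Then \<open>\<tau>(v) = 1 + \<Sum> x \<tau>(u) / (x + \<tau>(u))\<close> over the
  children \<open>u\<close> of \<open>v\<close>, and \<open>\<phi>(T, x)\<close> is \<open>\<tau>(r)\<close> times the product of \<open>x + \<tau>(v)\<close>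
  over \<open>v \<noteq> r\<close>.

  Fix two vertices and redistribute the branches hanging from them (on the sides away from each
  other). Up to a constant factor \<open>\<phi>\<close> is a bilinear form in the two local conductances with
  positive leading coefficient, hence strictly concave while their sum is fixed, so in a minimiser
  one of the two vertices carries as many branches as it may, all at least as heavy as those of the
  other. Descending level by level, of two disjoint branches with \<open>\<tau>(A) \<ge> \<tau>(B)\<close> the branch
  \<open>A\<close> is full on every level that \<open>B\<close> reaches. Rooting a minimiser where the
  conductance of the root is largest, this forces the greedy shape. The greedy shape is determined
  by the number of vertices, so the greedy tree is the only minimiser.
\<close>

section \<open>Rooted trees and their conductances\<close>

text \<open>Exchanges are carried out on unlabelled rooted trees. There, moving branches is a
  regrouping of multisets, isomorphism is equality, and only finitely many trees have a given number
  of nodes, so minimisers exist. Competitors have degree at most \<open>d + 1\<close>, not exactly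
  \<open>d + 1\<close>, since an exchange may destroy the only vertex of that degree; the greedy
  shape shows afterwards that the bound is attained.

  The linear part of the bilinear form is unknown, so an exchange only promises that one of two
  placements improves. This suffices because either vertex has room for \<open>d\<close> branches
  besides the side facing the other.

  The obstacle is the root. Exchanges between disjoint branches never compare a vertex with its own
  child, and an exchange along an edge helps only if the heavier side is known. The conductance of
  the root depends on the choice of root while \<open>phi\<close> does not; this freedom settles
  which side is heavier.

  All comparisons are made at one fixed \<open>x\<close>, and exchanges improve strictly, so
  equality at a single \<open>x\<close> already forces the shape.\<close>

datatype mtree = Node (subtrees: "mtree multiset")

primrec nodes :: "mtree \<Rightarrow> nat" where
  "nodes (Node M) = Suc (\<Sum>s\<in>#M. nodes s)"

definition series :: "real \<Rightarrow> real \<Rightarrow> real" where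
  "series x t = x * t / (x + t)"

text \<open>\<open>tau\<close> is the conductance \<open>\<tau>\<close> of a branch, \<open>phi\<close> is \<open>det (I + x L)\<close>, and \<open>phi0\<close> is the minor of
  \<open>I + x L\<close> obtained by deleting the row and column of the root.\<close>

primrec tau :: "real \<Rightarrow> mtree \<Rightarrow> real" where
  "tau x (Node M) = 1 + (\<Sum>s\<in>#M. series x (tau x s))"

text \<open>The determinant of the branch as a block of the whole matrix: the edge to the parent
  adds \<open>x\<close> to the diagonal entry of the branch's root, whence
  \<open>phi + x * phi0\<close> in \<open>wt_eq\<close>. The factors \<open>x + tau\<close> are the
  pivots met when leaves are eliminated first.\<close>

primrec wt :: "real \<Rightarrow> mtree \<Rightarrow> real" where
  "wt x (Node M) = (x + tau x (Node M)) * (\<Prod>s\<in>#M. wt x s)"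

definition phi0 :: "real \<Rightarrow> mtree \<Rightarrow> real" where
  "phi0 x t = (\<Prod>s\<in>#subtrees t. wt x s)"

definition phi :: "real \<Rightarrow> mtree \<Rightarrow> real" where
  "phi x t = tau x t * phi0 x t"

primrec bounded_tree :: "nat \<Rightarrow> mtree \<Rightarrow> bool" where
  "bounded_tree d (Node M) \<longleftrightarrow> size M \<le> d \<and> (\<forall>b\<in>#image_mset (bounded_tree d) M. b)"

text \<open>Degree at most \<open>d + 1\<close> everywhere: a vertex other than the root spends one
  edge on its parent. Both exchanges and moving the root across an edge stay inside this
  class.\<close>

definition admissible :: "nat \<Rightarrow> mtree \<Rightarrow> bool" where
  "admissible d t \<longleftrightarrow> size (subtrees t) \<le> d + 1 \<and> (\<forall>s\<in>#subtrees t. bounded_tree d s)"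

primrec full :: "nat \<Rightarrow> nat \<Rightarrow> mtree \<Rightarrow> bool" where
  "full d 0 t \<longleftrightarrow> True"
| "full d (Suc k) t \<longleftrightarrow> size (subtrees t) = d \<and> (\<forall>s\<in>#subtrees t. full d k s)"

primrec deep :: "nat \<Rightarrow> mtree \<Rightarrow> bool" where
  "deep 0 t \<longleftrightarrow> True"
| "deep (Suc k) t \<longleftrightarrow> (\<exists>s\<in>#subtrees t. deep k s)"

primrec complete_mtree :: "nat \<Rightarrow> nat \<Rightarrow> mtree" where
  "complete_mtree d 0 = Node {#}"
| "complete_mtree d (Suc h) = Node (replicate_mset d (complete_mtree d h))"

definition incomplete :: "nat \<Rightarrow> mtree \<Rightarrow> bool" where
  "incomplete d t \<longleftrightarrow> (\<forall>h. t \<noteq> complete_mtree d h)"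

primrec thin :: "nat \<Rightarrow> mtree \<Rightarrow> bool" where
  "thin d (Node M) \<longleftrightarrow> size (filter_mset (incomplete d) M) \<le> 1 \<and> (\<forall>b\<in>#image_mset (thin d) M. b)"

text \<open>For a tree of height \<open>H \<ge> 2\<close> the number \<open>j\<close> is \<open>H - 2\<close>; for a star it is \<open>0\<close>.\<close>

definition greedy_shape :: "nat \<Rightarrow> mtree \<Rightarrow> bool" where
  "greedy_shape d t \<longleftrightarrow> size (subtrees t) = d + 1 \<and> thin d t \<and>
     (\<exists>j. \<forall>s\<in>#subtrees t. bounded_tree d s \<and> full d j s \<and> \<not> deep (j + 2) s)"

lemma bounded_tree_Node [simp]:
  "bounded_tree d (Node M) \<longleftrightarrow> size M \<le> d \<and> (\<forall>s\<in>#M. bounded_tree d s)"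
  by simp

declare bounded_tree.simps [simp del]

lemma thin_Node [simp]:
  "thin d (Node M) \<longleftrightarrow> size (filter_mset (incomplete d) M) \<le> 1 \<and> (\<forall>s\<in>#M. thin d s)"
  by simp

declare thin.simps [simp del]

context
  fixes x :: real
  assumes x: "x > 0"
begin

lemma tau_ge_1: "tau x t \<ge> 1"
proof (induction t)
  case (Node M)
  have "series x (tau x s) \<ge> 0" if "s \<in># M" for s
    using Node[OF that] x by (auto simp: series_def)
  then have "(\<Sum>s\<in>#M. series x (tau x s)) \<ge> 0"
    by (induction M) auto
  then show ?case by simp
qed

lemma tau_pos: "tau x t > 0"
  using tau_ge_1[of t] by linarith

lemma wt_pos: "wt x t > 0"
proof (induction t)
  case (Node M)
  have "(\<Prod>s\<in>#M. wt x s) > 0" using Node by (induction M) auto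
  then show ?case using x tau_pos[of "Node M"] by simp
qed

lemma phi0_pos: "phi0 x t > 0"
proof -
  have "(\<Prod>s\<in>#M. wt x s) > 0" for M by (induction M) (auto simp: wt_pos)
  then show ?thesis by (simp add: phi0_def)
qed

lemma phi_pos: "phi x t > 0"
  using phi0_pos tau_pos by (simp add: phi_def)

lemma wt_eq: "wt x t = phi x t + x * phi0 x t"
  by (cases t) (simp add: phi_def phi0_def algebra_simps)

text \<open>With \<open>phi_add\<close>: hanging a branch on a root is linear in the pair
  (\<open>phi\<close>, \<open>phi0\<close>) of that branch. Working with this pair instead of
  \<open>tau\<close> keeps the recursion free of division.\<close>

lemma phi0_add: "phi0 x (Node (add_mset s M)) = phi0 x (Node M) * (phi x s + x * phi0 x s)"
  unfolding wt_eq[symmetric] by (simp add: phi0_def)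

lemma wt_series: "wt x s * series x (tau x s) = x * phi x s"
proof -
  have "wt x s = (x + tau x s) * phi0 x s"
    by (simp add: wt_eq phi_def algebra_simps)
  then show ?thesis
    using x tau_pos[of s] by (simp add: series_def phi_def)
qed

lemma phi_add: "phi x (Node (add_mset s M)) =
    phi x (Node M) * (phi x s + x * phi0 x s) + phi0 x (Node M) * (x * phi x s)"
proof -
  have "phi x (Node (add_mset s M)) = (tau x (Node M)
    + series x (tau x s)) * (phi0 x (Node M) * wt x s)"
    unfolding phi_def phi0_add wt_eq by simp
  also have "\<dots> = tau x (Node M) * phi0 x (Node M) * wt x s
    + phi0 x (Node M) * (wt x s * series x (tau x s))"
    by (simp del: tau.simps add: algebra_simps)
  finally show ?thesis by (simp only: wt_series) (simp add: phi_def wt_eq)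
qed

lemma series_pos: "t > 0 \<Longrightarrow> series x t > 0"
  using x by (simp add: series_def)

lemma series_strict_mono: "0 < s \<Longrightarrow> s < t \<Longrightarrow> series x s < series x t"
  using x by (simp add: series_def field_simps)

text \<open>Compares the root conductances at the two ends of an edge. If the sides of the edge have
  conductances \<open>s\<close> and \<open>t\<close>, these are \<open>s + series x t\<close> and
  \<open>t + series x s\<close>, so the end on the heavier side wins. The proof uses
  \<open>t - series x t = t * t / (x + t)\<close>.\<close>

lemma minus_series_mono:
  assumes "0 < s" "s < t"
  shows "s - series x s < t - series x t"
proof -
  have "s - series x s = s * s / (x + s)" "t - series x t = t * t / (x + t)"
    using x assms by (simp_all add: series_def field_simps)
  moreover have "s * s / (x + s) < t * t / (x + t)"
  proof -
    have "s * s < t * t" using assms by (intro mult_strict_mono) auto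
    moreover have "s * s * t < t * t * s" using assms by simp
    ultimately have "s * s * (x + t) < t * t * (x + s)"
      using x by (simp add: distrib_left add_strict_mono)
    then show ?thesis using x assms by (simp add: field_simps)
  qed
  ultimately show ?thesis by simp
qed

end

section \<open>Trees with one or two holes\<close>

definition biaffine :: "real \<Rightarrow> (mtree \<Rightarrow> mtree \<Rightarrow> mtree) \<Rightarrow> (mtree \<Rightarrow> real) \<Rightarrow> bool" where
  "biaffine x K g \<longleftrightarrow> (\<exists>A B C D. A > 0 \<and> (\<forall>a b. g (K a b) =
     A * phi x a * phi x b + B * phi x a * phi0 x b + C * phi0 x a * phi x b + D * phi0 x a * phi0 x
       b))"

text \<open>Contexts are functions, so that plugging in is application and extending a context
  downwards is composition.\<close>

inductive ctx1 :: "(mtree \<Rightarrow> mtree) \<Rightarrow> bool" where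
  hole: "ctx1 (\<lambda>a. a)"
| below: "ctx1 K \<Longrightarrow> ctx1 (\<lambda>a. Node (add_mset (K a) M))"

text \<open>Contexts with two holes, neither of which lies below the other.\<close>

inductive ctx2 :: "(mtree \<Rightarrow> mtree \<Rightarrow> mtree) \<Rightarrow> bool" where
  fork: "ctx1 K \<Longrightarrow> ctx1 L \<Longrightarrow> ctx2 (\<lambda>a b. Node (add_mset (K a) (add_mset (L b) M)))"
| below2: "ctx2 K \<Longrightarrow> ctx2 (\<lambda>a b. Node (add_mset (K a b) M))"

lemma ctx1_compose: "ctx1 K \<Longrightarrow> ctx1 L \<Longrightarrow> ctx1 (\<lambda>a. K (L a))"
  by (induction rule: ctx1.induct) (auto intro: ctx1.intros)

lemma ctx1_ctx2: "ctx1 K \<Longrightarrow> ctx2 L \<Longrightarrow> ctx2 (\<lambda>a b. K (L a b))"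
  by (induction rule: ctx1.induct) (auto intro: ctx2.intros)

lemma ctx2_compose: "ctx2 K \<Longrightarrow> ctx1 L \<Longrightarrow> ctx1 L' \<Longrightarrow> ctx2 (\<lambda>a b. K (L a) (L' b))"
  by (induction rule: ctx2.induct) (auto intro!: ctx2.intros intro: ctx1_compose)

lemma ctx1_hole: "ctx1 (\<lambda>a. Node (add_mset a M))"
  using below[OF hole] .

text \<open>Each edge on the way to the hole applies a linear map to the pair (\<open>phi\<close>,
  \<open>phi0\<close>). Nonnegative coefficients with positive diagonal are an invariant of this
  process, and the positive diagonal later yields the positive leading coefficient.\<close>

lemma ctx1_affine:
  assumes "ctx1 K" "x > 0"
  shows "\<exists>A B C D. A > 0 \<and> B \<ge> 0 \<and> C \<ge> 0 \<and> D > 0 \<and> (\<forall>a. phi x (K a) = A * phi x a + B * phi0 x a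
     \<and> phi0 x (K a) = C * phi x a + D * phi0 x a)"
  using assms(1)
proof (induction rule: ctx1.induct)
  case hole
  show ?case by (rule exI[of _ 1], rule exI[of _ 0], rule exI[of _ 0], rule exI[of _ 1]) simp
next
  case (below K M)
  then obtain A B C D where h: "A > 0" "B \<ge> 0" "C \<ge> 0" "D > 0"
    "\<And>a. phi x (K a) = A * phi x a + B * phi0 x a"
    "\<And>a. phi0 x (K a) = C * phi x a + D * phi0 x a" by blast
  define p q where "p = phi x (Node M)" and "q = phi0 x (Node M)"
  have pq: "p > 0" "q > 0" using phi_pos phi0_pos assms by (auto simp: p_def q_def)
  \<comment> \<open>\<open>E\<close> and \<open>F\<close> are the coefficients of
    \<open>wt x (K a)\<close>, the combination that enters both \<open>phi_add\<close> and
    \<open>phi0_add\<close>.\<close>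
  define E F where "E = A + x * C" and "F = B + x * D"
  have EF: "E > 0" "F > 0"
    using h(1-4) assms(2) by (simp_all add: E_def F_def add_pos_nonneg add_nonneg_pos)
  show ?case
    unfolding phi_add[OF assms(2)] phi0_add[OF assms(2)] h(5,6) p_def[symmetric] q_def[symmetric]
    apply (rule exI[of _ "p * E + q * x * A"], rule exI[of _ "p * F + q * x * B"],
      rule exI[of _ "q * E"], rule exI[of _ "q * F"])
    using h(1-4) pq EF assms(2)
      by (simp add: add_pos_pos add_pos_nonneg) (simp add: E_def F_def algebra_simps)
qed

text \<open>At the fork the form is a product of the two linear pairs. Above it, each edge takes a
  positive combination of the forms for \<open>phi\<close> and \<open>phi0\<close>; therefore both
  are carried, and both leading coefficients stay positive.\<close>

lemma ctx2_biaffine: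
  assumes "ctx2 K" "x > 0"
  shows "biaffine x K (phi x) \<and> biaffine x K (phi0 x)"
  using assms(1)
proof (induction rule: ctx2.induct)
  case (fork K L M)
  from ctx1_affine[OF fork(1) assms(2)] obtain A B C D where h: "A > 0" "B \<ge> 0" "C \<ge> 0" "D > 0"
    "\<And>a. phi x (K a) = A * phi x a + B * phi0 x a"
    "\<And>a. phi0 x (K a) = C * phi x a + D * phi0 x a" by blast
  from ctx1_affine[OF fork(2) assms(2)] obtain A' B' C' D'
    where h': "A' > 0" "B' \<ge> 0" "C' \<ge> 0" "D' > 0"
    "\<And>a. phi x (L a) = A' * phi x a + B' * phi0 x a"
    "\<And>a. phi0 x (L a) = C' * phi x a + D' * phi0 x a" by blast
  define p q where "p = phi x (Node M)" and "q = phi0 x (Node M)"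
  have pq: "p > 0" "q > 0" using phi_pos phi0_pos assms by (auto simp: p_def q_def)
  note eqs = phi_add[OF assms(2)] phi0_add[OF assms(2)] h(5,6) h'(5,6) p_def[symmetric]
    q_def[symmetric]
  define E F E' F' where "E = A + x * C" and "F = B + x * D" and "E' = A' + x * C'"
    and "F' = B' + x * D'"
  have EF: "E > 0" "F > 0" "E' > 0" "F' > 0"
    using h(1-4) h'(1-4) assms(2)
      by (simp_all add: E_def F_def E'_def F'_def add_pos_nonneg add_nonneg_pos)
  show ?case
  proof
    show "biaffine x (\<lambda>a b. Node (add_mset (K a) (add_mset (L b) M))) (phi x)"
      unfolding biaffine_def eqs
      apply (rule exI[of _ "p * E * E' + q * x * A' * E + q * E' * x * A"],
          rule exI[of _ "p * E * F' + q * x * B' * E + q * F' * x * A"],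
          rule exI[of _ "p * F * E' + q * x * A' * F + q * E' * x * B"],
          rule exI[of _ "p * F * F' + q * x * B' * F + q * F' * x * B"])
      using pq EF h(1) h'(1) assms(2)
        by (simp add: add_pos_pos) (simp add: E_def F_def E'_def F'_def algebra_simps)
    show "biaffine x (\<lambda>a b. Node (add_mset (K a) (add_mset (L b) M))) (phi0 x)"
      unfolding biaffine_def eqs
      apply (rule exI[of _ "q * E * E'"], rule exI[of _ "q * E * F'"],
          rule exI[of _ "q * F * E'"], rule exI[of _ "q * F * F'"])
      using pq EF by simp (simp add: E_def F_def E'_def F'_def algebra_simps)
  qed
next
  case (below2 K M)
  then obtain A B C D A' B' C' D' where h: "A > 0" "A' > 0"
    "\<And>a b. phi x (K a b) = A * phi x a * phi x b + B * phi x a * phi0 x b + C * phi0 x a * phi x b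
      + D * phi0 x a * phi0 x b"
    "\<And>a b. phi0 x (K a b) = A' * phi x a * phi x b + B' * phi x a * phi0 x b
      + C' * phi0 x a * phi x b + D' * phi0 x a * phi0 x b"
    unfolding biaffine_def by blast
  define p q where "p = phi x (Node M)" and "q = phi0 x (Node M)"
  have pq: "p > 0" "q > 0" using phi_pos phi0_pos assms by (auto simp: p_def q_def)
  note eqs = phi_add[OF assms(2)] phi0_add[OF assms(2)] h(3,4) p_def[symmetric] q_def[symmetric]
  show ?case
  proof
    show "biaffine x (\<lambda>a b. Node (add_mset (K a b) M)) (phi x)"
      unfolding biaffine_def eqs
      apply (rule exI[of _ "p * (A + x * A') + q * x * A"], rule exI[of _ "p * (B + x * B')
        + q * x * B"],
          rule exI[of _ "p * (C + x * C') + q * x * C"], rule exI[of _ "p * (D + x * D')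
            + q * x * D"])
      using pq h(1,2) assms(2) by (auto simp: algebra_simps intro!: add_pos_pos)
    show "biaffine x (\<lambda>a b. Node (add_mset (K a b) M)) (phi0 x)"
      unfolding biaffine_def eqs
      apply (rule exI[of _ "q * (A + x * A')"], rule exI[of _ "q * (B + x * B')"],
          rule exI[of _ "q * (C + x * C')"], rule exI[of _ "q * (D + x * D')"])
      using pq h(1,2) assms(2) by (auto simp: algebra_simps intro!: add_pos_pos)
  qed
qed

section \<open>Minimisers\<close>

definition branch_sum :: "real \<Rightarrow> mtree multiset \<Rightarrow> real" where
  "branch_sum x X = (\<Sum>s\<in>#X. series x (tau x s))"

lemma tau_branch_sum [simp]: "tau x (Node X) = 1 + branch_sum x X"
  by (simp add: branch_sum_def)

declare tau.simps [simp del]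

lemma branch_sum_add [simp]: "branch_sum x (add_mset s X) = branch_sum x X + series x (tau x s)"
  by (simp add: branch_sum_def)

lemma phi0_union: "phi0 x (Node X) * phi0 x (Node Y) = (\<Prod>s\<in>#X + Y. wt x s)"
  by (simp add: phi0_def)

text \<open>Spreading two numbers further apart at constant sum lowers their product. The linear
  part may grow for one order of the spread pair but not for both; the sign of \<open>B - C\<close>
  tells which order to take.\<close>

lemma concave_exchange:
  fixes A B C D a b a' b' :: real
  assumes "A > 0" "a + b = a' + b'" "b \<le> a" "a < a'"
  shows "A * a' * b' + B * a' + C * b' + D < A * a * b + B * a + C * b + D \<or>
    A * b' * a' + B * b' + C * a' + D < A * a * b + B * a + C * b + D"
proof -
  define e where "e = a' - a"
  have e: "a' = a + e" "b' = b - e" "e > 0" using assms by (auto simp: e_def)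
  have "(a + e) * (b - e) < a * b"
  proof -
    have "(a + e) * (b - e) = a * b - e * (a - b) - e * e" by (simp add: algebra_simps)
    moreover have "e * (a - b) \<ge> 0" "e * e > 0" using e assms by auto
    ultimately show ?thesis by linarith
  qed
  then have 1: "A * ((a + e) * (b - e)) < A * (a * b)" using assms by simp
  show ?thesis
  proof (cases "B \<le> C")
    case True
    then have "(C - B) * e \<ge> 0" using e by simp
    then have "B * (a + e) + C * (b - e) \<le> B * a + C * b" by (simp add: algebra_simps)
    then show ?thesis using 1 unfolding e by (simp add: mult.assoc)
  next
    case False
    then have "(B - C) * (a - b + e) \<ge> 0" using e assms by simp
    then have "B * (b - e) + C * (a + e) \<le> B * a + C * b" by (simp add: algebra_simps)
    then show ?thesis using 1 unfolding e by (simp add: mult.assoc mult.commute[of "b - e"])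
  qed
qed

text \<open>Since \<open>phi = tau * phi0\<close>, the form is
  \<open>phi0 x (Node X) * phi0 x (Node Y)\<close> times a biaffine function of the two
  conductances. The first factor depends only on the pooled branches \<open>X + Y\<close>, and so
  does the sum of the conductances, so \<open>concave_exchange\<close> applies.\<close>

lemma phi_exchange:
  assumes "x > 0" "biaffine x K (phi x)" "X + Y = X' + Y'" "branch_sum x Y \<le> branch_sum x X"
    "branch_sum x X < branch_sum x X'"
  shows "phi x (K (Node X') (Node Y')) < phi x (K (Node X) (Node Y)) \<or>
    phi x (K (Node Y') (Node X')) < phi x (K (Node X) (Node Y))"
proof -
  obtain A B C D where A: "A > 0" and h: "\<And>a b. phi x (K a b) =
     A * phi x a * phi x b + B * phi x a * phi0 x b + C * phi0 x a * phi x b + D * phi0 x a * phi0 x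
       b"
    using assms(2) unfolding biaffine_def by blast
  define P where "P = phi0 x (Node X) * phi0 x (Node Y)"
  have P: "P > 0" unfolding P_def using phi0_pos[OF assms(1)] by simp
  have P': "P = phi0 x (Node X') * phi0 x (Node Y')" unfolding P_def phi0_union assms(3) ..
  have P'': "P = phi0 x (Node Y') * phi0 x (Node X')" unfolding P' by (rule mult.commute)
  have K: "phi x (K (Node U) (Node V)) = (phi0 x (Node U) * phi0 x (Node V)) *
      (A * (1 + branch_sum x U) * (1 + branch_sum x V) + B * (1 + branch_sum x U) + C * (1 +
        branch_sum x V) + D)" for U V
    unfolding h unfolding phi_def tau_branch_sum by (simp add: algebra_simps)
  have sum: "(1 + branch_sum x X) + (1 + branch_sum x Y) = (1 + branch_sum x X') + (1
    + branch_sum x Y')"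
    using arg_cong[OF assms(3), of "branch_sum x"] by (simp add: branch_sum_def)
  show ?thesis
    using concave_exchange[OF A sum, of B C D] assms(4,5)
    unfolding K P_def[symmetric] P'[symmetric] P''[symmetric] mult_less_cancel_left_pos[OF P]
    by simp
qed

definition optimal :: "nat \<Rightarrow> real \<Rightarrow> mtree \<Rightarrow> bool" where
  "optimal d x t \<longleftrightarrow> admissible d t \<and> (\<forall>t'. admissible d t' \<and> nodes t' = nodes t
    \<longrightarrow> phi x t \<le> phi x t')"

text \<open>Abstracts from how the two vertices sit in the tree, so that one separation lemma serves
  both disjoint vertices (\<open>swappable_ctx2\<close>) and a root with one of its children
  (\<open>swappable_join\<close>).\<close>

definition swappable :: "nat \<Rightarrow> (mtree \<Rightarrow> mtree \<Rightarrow> mtree) \<Rightarrow> bool" where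
  "swappable d K \<longleftrightarrow> (\<forall>X Y X' Y'. admissible d (K (Node X) (Node Y)) \<longrightarrow> X + Y = X' + Y' \<longrightarrow>
     size X' \<le> d \<longrightarrow> size Y' \<le> d \<longrightarrow>
     admissible d (K (Node X') (Node Y')) \<and> nodes (K (Node X') (Node Y')) = nodes (K (Node X) (Node
       Y)))"

text \<open>Otherwise moving \<open>y\<close> across, or trading it for a lighter branch of
  \<open>X\<close>, makes the heavier side heavier still. One of the two placements of the new pair
  then has smaller \<open>phi\<close>, and both are competitors, since the size bound
  \<open>d\<close> is the same for both vertices.\<close>

lemma optimal_separated:
  assumes "x > 0" "biaffine x K (phi x)" "swappable d K" "optimal d x (K (Node X) (Node Y))"
    and "size X \<le> d" "size Y \<le> d" "tau x (Node Y) \<le> tau x (Node X)" "y \<in># Y"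
  shows "size X = d \<and> (\<forall>a\<in>#X. tau x y \<le> tau x a)"
proof -
  have leXY: "branch_sum x Y \<le> branch_sum x X" using assms(7) by (simp add: tau_branch_sum)
  have no: False if e: "X + Y = X' + Y'" and s: "size X' \<le> d" "size Y' \<le> d"
    and f: "branch_sum x X < branch_sum x X'" for X' Y'
  proof -
    have e': "X + Y = Y' + X'" using e by (simp add: add.commute)
    have le: "phi x (K (Node X) (Node Y)) \<le> phi x (K (Node U) (Node V))"
      if uv: "X + Y = U + V" "size U \<le> d" "size V \<le> d" for U V
    proof -
      have "admissible d (K (Node X) (Node Y))" using assms(4) by (simp add: optimal_def)
      then have "admissible d (K (Node U) (Node V))" "nodes (K (Node U) (Node V))
        = nodes (K (Node X) (Node Y))"
        using assms(3)[unfolded swappable_def, rule_format, OF _ uv] by auto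
      then show ?thesis using assms(4) by (simp add: optimal_def)
    qed
    from le[OF e s] le[OF e' s(2,1)] show False using phi_exchange[OF assms(1,2) e leXY f]
      by linarith
  qed
  obtain Y0 where Y: "Y = add_mset y Y0" using multi_member_split[OF assms(8)] by blast
  have "size X = d"
  proof (rule ccontr)
    assume "size X \<noteq> d"
    then have 1: "size (add_mset y X) \<le> d" using assms(5) by simp
    have 2: "size Y0 \<le> d" using assms(6) unfolding Y by simp
    have 3: "X + Y = add_mset y X + Y0" unfolding Y by simp
    have 4: "branch_sum x X < branch_sum x (add_mset y X)"
      using series_pos[OF assms(1) tau_pos[OF assms(1)], of y] by simp
    show False by (rule no[OF 3 1 2 4])
  qed
  moreover have "tau x y \<le> tau x a" if "a \<in># X" for a
  proof (rule ccontr)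
    assume less: "\<not> tau x y \<le> tau x a"
    from multi_member_split[OF that] obtain X0 where X: "X = add_mset a X0" by blast
    have 1: "size (add_mset y X0) \<le> d" using assms(5) unfolding X by simp
    have 2: "size (add_mset a Y0) \<le> d" using assms(6) unfolding Y by simp
    have 3: "X + Y = add_mset y X0 + add_mset a Y0" unfolding X Y by (simp add: add_mset_commute)
    have 4: "branch_sum x X < branch_sum x (add_mset y X0)"
      using series_strict_mono[OF assms(1) tau_pos[OF assms(1), of a], of "tau x y"] less
        unfolding X by simp
    show False by (rule no[OF 3 1 2 4])
  qed
  ultimately show ?thesis by blast
qed

section \<open>Degree bounds and node counts under exchange\<close>

lemma bounded_ctx1:
  assumes "ctx1 K" "bounded_tree d (K a)"
  shows "bounded_tree d a \<and> (bounded_tree d b \<longrightarrow> bounded_tree d (K b))"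
  using assms by (induction rule: ctx1.induct) auto

lemma nodes_ctx1:
  assumes "ctx1 K"
  shows "nodes (K a) + nodes b = nodes (K b) + nodes a"
  using assms by (induction rule: ctx1.induct) auto

lemma bounded_ctx2:
  assumes "ctx2 K" "bounded_tree d (K a b)"
  shows "bounded_tree d a \<and> bounded_tree d b \<and>
    (bounded_tree d a' \<longrightarrow> bounded_tree d b' \<longrightarrow> bounded_tree d (K a' b'))"
  using assms by (induction rule: ctx2.induct) (auto dest: bounded_ctx1)

lemma nodes_ctx2:
  assumes "ctx2 K"
  shows "nodes (K a b) + nodes a' + nodes b' = nodes (K a' b') + nodes a + nodes b"
  using assms
proof (induction rule: ctx2.induct)
  case (fork K L M)
  then show ?case using nodes_ctx1[of K a a'] nodes_ctx1[of L b b'] by simp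
qed auto

lemma admissible_ctx2:
  assumes "ctx2 K" "admissible d (K a b)"
  shows "bounded_tree d a \<and> bounded_tree d b \<and>
    (bounded_tree d a' \<longrightarrow> bounded_tree d b' \<longrightarrow> admissible d (K a' b'))"
  using assms
  by (induction rule: ctx2.induct) (auto simp: admissible_def dest: bounded_ctx1 bounded_ctx2)

lemma nodes_union: "X + Y = X' + Y' \<Longrightarrow> nodes (Node X) + nodes (Node Y) = nodes (Node X')
  + nodes (Node Y')"
proof -
  assume "X + Y = X' + Y'"
  then have "(\<Sum>s\<in>#X + Y. nodes s) = (\<Sum>s\<in>#X' + Y'. nodes s)" by (rule arg_cong)
  then show ?thesis by simp
qed

lemma swappable_ctx2:
  assumes "ctx2 K"
  shows "swappable d K"
  unfolding swappable_def
proof (intro allI impI)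
  fix X Y X' Y'
  assume h: "admissible d (K (Node X) (Node Y))" "X + Y = X' + Y'" "size X' \<le> d" "size Y' \<le> d"
  from admissible_ctx2[OF assms h(1)]
  have "\<forall>s\<in>#X + Y. bounded_tree d s" by auto
  then have "\<forall>s\<in>#X' + Y'. bounded_tree d s" unfolding h(2) .
  then have "bounded_tree d (Node X')" "bounded_tree d (Node Y')" using h(3,4) by auto
  then have "admissible d (K (Node X') (Node Y'))" using admissible_ctx2[OF assms h(1)] by blast
  moreover have "nodes (K (Node X') (Node Y')) = nodes (K (Node X) (Node Y))"
    using nodes_ctx2[OF assms, of "Node X'" "Node Y'" "Node X" "Node Y"] nodes_union[OF h(2)]
      by linarith
  ultimately show "admissible d (K (Node X') (Node Y')) \<and> nodes (K (Node X') (Node Y'))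
    = nodes (K (Node X) (Node Y))" ..
qed

text \<open>The child \<open>y\<close> through which \<open>B\<close> reaches its depth is no
  heavier than any child \<open>a\<close> of \<open>A\<close>, by separation. As \<open>a\<close>
  and \<open>y\<close> again fill the holes of a two-hole context, the induction continues with
  them; for this the context has to vary.\<close>

lemma deep_imp_full:
  assumes "x > 0" "optimal d x t"
  shows "ctx2 K \<Longrightarrow> t = K A B \<Longrightarrow> tau x B \<le> tau x A \<Longrightarrow> deep k B \<Longrightarrow> full d k A"
proof (induction k arbitrary: K A B)
  case (Suc k)
  obtain X Y where AB: "A = Node X" "B = Node Y" by (metis mtree.exhaust)
  obtain y where y: "y \<in># Y" "deep k y" using Suc.prems(4) by (auto simp: AB)
  have opt: "optimal d x (K (Node X) (Node Y))" using assms(2) Suc.prems(2) by (simp add: AB)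
  then have adm: "admissible d (K (Node X) (Node Y))" by (simp add: optimal_def)
  have "bounded_tree d A" "bounded_tree d B"
    using admissible_ctx2[OF Suc.prems(1) adm] by (simp_all add: AB)
  then have size: "size X \<le> d" "size Y \<le> d" by (auto simp: AB)
  have sep: "size X = d \<and> (\<forall>a\<in>#X. tau x y \<le> tau x a)"
    using optimal_separated[OF assms(1) _ swappable_ctx2[OF Suc.prems(1)] opt size _ y(1)]
      ctx2_biaffine[OF Suc.prems(1) assms(1)] Suc.prems(3) by (simp add: AB)
  have "full d k a" if a: "a \<in># X" for a
  proof -
    obtain X0 where X: "X = add_mset a X0" using multi_member_split[OF a] by blast
    obtain Y0 where Y: "Y = add_mset y Y0" using multi_member_split[OF y(1)] by blast
    have "t = K (Node (add_mset a X0)) (Node (add_mset y Y0))" using Suc.prems(2)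
      by (simp add: AB X Y)
    then show ?thesis
      using Suc.IH[OF ctx2_compose[OF Suc.prems(1) ctx1_hole[of X0] ctx1_hole[of Y0]]] sep a y(2)
        by blast
  qed
  then show ?case using sep by (simp add: AB)
qed simp

lemma full_deep: "0 < d \<Longrightarrow> full d k t \<Longrightarrow> deep k t"
  by (induction k arbitrary: t) (auto dest!: size_eq_Suc_imp_elem simp: gr0_conv_Suc intro!: bexI)

lemma deep_less_nodes: "deep k t \<Longrightarrow> k < nodes t"
proof (induction k arbitrary: t)
  case 0
  then show ?case by (cases t) simp
next
  case (Suc k)
  obtain M where t: "t = Node M" by (cases t)
  obtain s where s: "s \<in># M" "deep k s" using Suc.prems by (auto simp: t)
  obtain M0 where "M = add_mset s M0" using multi_member_split[OF s(1)] by blast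
  then show ?case using Suc.IH[OF s(2)] by (simp add: t)
qed

lemma deep_antimono: "deep (Suc k) t \<Longrightarrow> deep k t"
  by (induction k arbitrary: t) auto

lemma eq_replicate_mset: "\<forall>s\<in>#M. s = c \<Longrightarrow> size M = m \<Longrightarrow> M = replicate_mset m c"
  by (induction M arbitrary: m) auto

lemma full_eq_complete: "full d k t \<Longrightarrow> \<not> deep (Suc k) t \<Longrightarrow> t = complete_mtree d k"
proof (induction k arbitrary: t)
  case 0
  then show ?case by (cases t) (auto simp: multiset_eq_iff not_in_iff)
next
  case (Suc k)
  obtain M where t: "t = Node M" by (cases t)
  have "\<forall>s\<in>#M. s = complete_mtree d k" using Suc by (auto simp: t)
  moreover have "size M = d" using Suc.prems by (simp add: t)
  ultimately have "M = replicate_mset d (complete_mtree d k)" by (rule eq_replicate_mset)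
  then show ?case by (simp add: t)
qed

text \<open>Look at the lighter branch. If it reaches depth \<open>j + 1\<close>, the heavier one is
  full on \<open>j + 1\<close> levels and ends there, hence is complete. If it does not, it is
  itself full on \<open>j\<close> levels and ends there.\<close>

lemma not_complete_pair:
  assumes "x > 0" "optimal d x t" "0 < d" "ctx1 K" "t = K (Node (add_mset a (add_mset b M)))"
    "full d j a" "\<not> deep (j + 2) a" "full d j b" "\<not> deep (j + 2) b"
  shows "\<not> incomplete d a \<or> \<not> incomplete d b"
proof -
  have *: "\<not> incomplete d a \<or> \<not> incomplete d b"
    if t: "t = K (Node (add_mset a (add_mset b M)))" and ab: "tau x b \<le> tau x a"
       "\<not> deep (j + 2) a" "full d j b" for a b
  proof -
    have c: "ctx2 (\<lambda>a b. K (Node (add_mset a (add_mset b M))))"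
      by (rule ctx1_ctx2[OF assms(4)]) (rule ctx2.fork[OF hole hole])
    show ?thesis
    proof (cases "deep (Suc j) b")
      case True
      then have "full d (Suc j) a" by (rule deep_imp_full[OF assms(1,2) c t ab(1)])
      moreover have "\<not> deep (Suc (Suc j)) a" using ab(2) by simp
      ultimately have "a = complete_mtree d (Suc j)" by (rule full_eq_complete)
      then show ?thesis unfolding incomplete_def by blast
    next
      case False
      then show ?thesis using full_eq_complete[of d j b] ab(3) unfolding incomplete_def by auto
    qed
  qed
  show ?thesis
  proof (cases "tau x b \<le> tau x a")
    case True
    show ?thesis by (rule *[OF assms(5) True assms(7,8)])
  next
    case False
    have t: "t = K (Node (add_mset b (add_mset a M)))" by (simp only: assms(5) add_mset_commute)
    have "tau x a \<le> tau x b" using False by simp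
    from *[OF t this assms(9,6)] show ?thesis by blast
  qed
qed

lemma size_filter_le_1:
  assumes "\<And>a b M'. M = add_mset a (add_mset b M') \<Longrightarrow> \<not> P a \<or> \<not> P b"
  shows "size (filter_mset P M) \<le> 1"
proof (rule ccontr)
  assume h: "\<not> ?thesis"
  obtain a N where 1: "filter_mset P M = add_mset a N" using h by (cases "filter_mset P M") auto
  obtain b N' where 2: "N = add_mset b N'" using h 1 by (cases N) auto
  have "M = filter_mset P M + filter_mset (\<lambda>s. \<not> P s) M" by (simp add: multiset_partition)
  then have "M = add_mset a (add_mset b (N' + filter_mset (\<lambda>s. \<not> P s) M))" using 1 2 by simp
  moreover have "a \<in># filter_mset P M" "b \<in># filter_mset P M" using 1 2 by auto
  then have "P a" "P b" by auto
  ultimately show False using assms by blast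
qed

text \<open>At every vertex the child branches share one depth range, so
  \<open>not_complete_pair\<close> applies to any two of them; one level down the range shifts by
  one.\<close>

lemma optimal_thin:
  assumes "x > 0" "optimal d x t" "0 < d"
  shows "ctx1 K \<Longrightarrow> t = K s \<Longrightarrow> \<forall>u\<in>#subtrees s. full d j u \<and> \<not> deep (j + 2) u \<Longrightarrow> thin d s"
proof (induction s arbitrary: K j)
  case (Node M)
  have "size (filter_mset (incomplete d) M) \<le> 1"
  proof (rule size_filter_le_1)
    fix a b M'
    assume M: "M = add_mset a (add_mset b M')"
    then show "\<not> incomplete d a \<or> \<not> incomplete d b"
      using not_complete_pair[OF assms Node.prems(1), of a b M' j] Node.prems(2,3)
        by (simp del: deep.simps)
  qed
  moreover have "thin d s" if s: "s \<in># M" for s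
  proof -
    obtain M0 where M: "M = add_mset s M0" using multi_member_split[OF s] by blast
    have s': "full d j s" "\<not> deep (j + 2) s" using Node.prems(3) s by auto
    \<comment> \<open>At \<open>j = 0\<close> the truncated subtraction leaves \<open>j\<close>
      unchanged. The fullness condition is then empty and the depth bound is only weakened.\<close>
    have "full d (j - 1) u \<and> \<not> deep (j - 1 + 2) u" if "u \<in># subtrees s" for u
    proof (cases j)
      case 0
      then show ?thesis using s' that deep_antimono[of 1 u] by auto
    next
      case (Suc i)
      then show ?thesis using s' that by auto
    qed
    then show ?thesis
      using Node.IH[OF s ctx1_compose[OF Node.prems(1) ctx1_hole[of M0]], of "j - 1"] Node.prems(2)
      by (simp add: M)
  qed
  ultimately show ?case by simp
qed

text \<open>The two ends of an edge are not holes of a \<open>ctx2\<close>, so this case is computed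
  directly: \<open>a\<close> is the root without its child \<open>b\<close>. The form is symmetric
  in \<open>a\<close> and \<open>b\<close>, which is also why \<open>phi\<close> does not change
  when the root moves across the edge.\<close>

lemma phi_join:
  assumes "x > 0"
  shows "phi x (Node (add_mset b (subtrees a))) = 1 * phi x a * phi x b + x * phi x a * phi0 x b
    + x * phi0 x a * phi x b + 0 * phi0 x a * phi0 x b"
  using phi_add[OF assms, of b "subtrees a"] by (simp add: algebra_simps)

lemma biaffine_join: "x > 0 \<Longrightarrow> biaffine x (\<lambda>a b. Node (add_mset b (subtrees a))) (phi x)"
  unfolding biaffine_def phi_join
  by (rule exI[of _ 1], rule exI[of _ x], rule exI[of _ x], rule exI[of _ 0]) simp

lemma swappable_join: "swappable d (\<lambda>a b. Node (add_mset b (subtrees a)))"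
  unfolding swappable_def
proof (intro allI impI)
  fix X Y X' Y' :: "mtree multiset"
  assume h: "admissible d (Node (add_mset (Node Y) (subtrees (Node X))))" "X + Y = X' + Y'"
    "size X' \<le> d" "size Y' \<le> d"
  from h(1) have "\<forall>s\<in>#X + Y. bounded_tree d s" by (auto simp: admissible_def)
  then have "\<forall>s\<in>#X' + Y'. bounded_tree d s" unfolding h(2) .
  then have b: "bounded_tree d (Node Y')" "\<forall>s\<in>#X'. bounded_tree d s" using h(4) by auto
  have "admissible d (Node (add_mset (Node Y') X'))" unfolding admissible_def using b h(3) by auto
  then show "admissible d (Node (add_mset (Node Y') (subtrees (Node X')))) \<and>
    nodes (Node (add_mset (Node Y') (subtrees (Node X')))) = nodes (Node (add_mset (Node Y)
      (subtrees (Node X))))"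
    using nodes_union[OF h(2)] by simp
qed

text \<open>By \<open>rot\<close> no neighbour of the root has larger conductance than the root.
  Hence for every child the rest of the tree is at least as heavy as the child's branch, and the
  exchange along that edge can be used. What remains is to bring all branches of the root into one
  depth range; thinness then follows from \<open>optimal_thin\<close>.\<close>

lemma optimal_greedy_shape:
  assumes x: "x > 0" and d: "0 < d" and opt: "optimal d x t" and n: "nodes t \<ge> d + 2"
    and rot: "\<And>X Y. t = Node (add_mset (Node Y) X) \<Longrightarrow> tau x (Node (add_mset (Node X) Y)) \<le> tau x t"
  shows "greedy_shape d t"
proof -
  obtain M where t: "t = Node M" by (cases t)
  have adm: "size M \<le> d + 1" "\<forall>s\<in>#M. bounded_tree d s" using opt
    by (auto simp: optimal_def admissible_def t)
  \<comment> \<open>Separation across the edge from the root to a child \<open>w\<close>: if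
    \<open>w\<close> has a child, the root has exactly \<open>d\<close> other children, none lighter
    than any child of \<open>w\<close>.\<close>
  have root: "size X = d \<and> (\<forall>a\<in>#X. tau x y \<le> tau x a)" if M: "M = add_mset w X"
    and y: "y \<in># subtrees w" for w X y
  proof -
    obtain Y where w: "w = Node Y" by (cases w)
    have "tau x (Node Y) \<le> tau x (Node X)"
    proof (rule ccontr)
      assume "\<not> ?thesis"
      then have "tau x (Node X) - series x (tau x (Node X)) < tau x (Node Y) - series x (tau x (Node
        Y))"
        using minus_series_mono[OF x tau_pos[OF x, of "Node X"], of "tau x (Node Y)"] by linarith
      then show False using rot[of Y X] by (simp add: t M w)
    qed
    moreover have o': "optimal d x (Node (add_mset (Node Y) X))" using opt by (simp add: t M w)
    moreover have "size X \<le> d" "size Y \<le> d" using adm by (auto simp: M w)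
    ultimately show ?thesis
      using optimal_separated[OF x biaffine_join[OF x] swappable_join, where X = X and Y = Y
        and y = y] o' y
      by (simp del: tau_branch_sum add: w)
  qed
  have pair: "full d k a" if "M = add_mset a (add_mset b X)" "tau x b \<le> tau x a" "deep k b"
    for a b X k
  proof (rule deep_imp_full[OF x opt ctx2.fork[OF hole hole, of X] _ that(2,3)])
    show "t = Node (add_mset a (add_mset b X))" unfolding t that(1) ..
  qed
  \<comment> \<open>Compares branches of different levels, a child of the root with a grandchild.
    The weight comparison for this comes from \<open>root\<close>.\<close>
  have pair2: "full d k a"
    if h: "M = add_mset a (add_mset b X)" "y \<in># subtrees b" "tau x y \<le> tau x a" "deep k y"
      for a b X y k
  proof -
    obtain Y where "subtrees b = add_mset y Y" using multi_member_split[OF h(2)] by blast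
    then have b: "b = Node (add_mset y Y)" by (cases b) simp
    show ?thesis
    proof (rule deep_imp_full[OF x opt ctx2.fork[OF hole ctx1_hole[of Y], of X] _ h(3,4)])
      show "t = Node (add_mset a (add_mset (Node (add_mset y Y)) X))" unfolding t h(1) b ..
    qed
  qed
  have bal: "size M = d + 1 \<and> (\<exists>j. \<forall>s\<in>#M. full d j s \<and> \<not> deep (j + 2) s)"
  proof (cases "\<exists>s\<in>#M. deep 1 s")
    \<comment> \<open>The tree is a star, and only the lower bound on the number of nodes tells that
      its root has \<open>d + 1\<close> children.\<close>
    case False
    have "\<forall>s\<in>#M. s = Node {#}"
    proof
      fix s assume "s \<in># M"
      then have "\<not> deep (Suc 0) s" using False by auto
      then have "s = complete_mtree d 0" by (intro full_eq_complete) auto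
      then show "s = Node {#}" by simp
    qed
    from eq_replicate_mset[OF this refl] have "(\<Sum>s\<in>#M. nodes s)
      = (\<Sum>s\<in>#replicate_mset (size M) (Node {#}). nodes s)"
      by (rule arg_cong)
    then have "nodes t = Suc (size M)" by (simp add: t)
    then have "size M = d + 1" using n adm by simp
    moreover have "full d 0 s \<and> \<not> deep (0 + 2) s" if "s \<in># M" for s
      using False that deep_antimono[of 1 s] by (auto simp: numeral_2_eq_2)
    ultimately show ?thesis by blast
  next
    case True
    \<comment> \<open>The last \<open>k\<close> with \<open>P k\<close> makes \<open>k + 1\<close>
      the greatest depth reached inside a branch of the root; \<open>w\<close> is a branch reaching
      it.\<close>
    define P where "P = (\<lambda>k. \<exists>s\<in>#M. deep (Suc k) s)"
    have "P 0" using True by (simp add: P_def)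
    have "\<not> P (nodes t)"
    proof
      assume "P (nodes t)"
      then have "deep (Suc (Suc (nodes t))) t" by (auto simp: P_def t)
      then show False using deep_less_nodes[of "Suc (Suc (nodes t))" t] by simp
    qed
    then obtain k where k: "P k" "\<not> P (Suc k)" using \<open>P 0\<close> nat_induct[of P "nodes t"] by blast
    then obtain w where w: "w \<in># M" "deep (Suc k) w" by (auto simp: P_def)
    have nd: "\<not> deep (k + 2) s" if "s \<in># M" for s using k(2) that by (auto simp: P_def)
    obtain y where y: "y \<in># subtrees w" "deep k y" using w(2) by auto
    obtain X where X: "M = add_mset w X" using multi_member_split[OF w(1)] by blast
    from root[OF X y(1)] have sX: "size X = d" and tX: "\<forall>a\<in>#X. tau x y \<le> tau x a" by auto
    have fX: "full d k a" if a: "a \<in># X" for a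
    proof -
      obtain X0 where "X = add_mset a X0" using multi_member_split[OF a] by blast
      then have "M = add_mset a (add_mset w X0)" unfolding X by (simp only: add_mset_commute)
      then show ?thesis by (rule pair2[OF _ y(1) _ y(2)]) (use tX a in blast)
    qed
    obtain a X0 where a: "X = add_mset a X0" using sX d by (cases X) auto
    have wa: "M = add_mset w (add_mset a X0)" unfolding X a ..
    have aw: "M = add_mset a (add_mset w X0)" unfolding X a by (simp only: add_mset_commute)
    \<comment> \<open>The other branches are full on \<open>k\<close> levels by comparison with
      \<open>y\<close> below \<open>w\<close>. For \<open>w\<close> itself take a sibling
      \<open>a\<close>. If \<open>a\<close> is not heavier, its depth \<open>k\<close> forces
      \<open>w\<close> to be full. If it is heavier, the depth of \<open>w\<close> makes
      \<open>a\<close> full on \<open>k + 1\<close> levels, and a child \<open>z\<close> of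
      \<open>a\<close> now plays for \<open>w\<close> the part that \<open>y\<close> played for
      \<open>a\<close>.\<close>
    have "full d k w"
    proof (cases "tau x a \<le> tau x w")
      case True
      have "deep k a" using full_deep[OF d fX] a by simp
      then show ?thesis by (rule pair[OF wa True])
    next
      case False
      then have "tau x w \<le> tau x a" by simp
      then have "full d (Suc k) a" using w(2) by (rule pair[OF aw])
      then have "deep (Suc k) a" by (rule full_deep[OF d])
      then obtain z where z: "z \<in># subtrees a" "deep k z" by auto
      then have "tau x z \<le> tau x w" using root[OF aw z(1)] by simp
      then show ?thesis using z by (intro pair2[OF wa])
    qed
    then have "\<forall>s\<in>#M. full d k s \<and> \<not> deep (k + 2) s" using fX nd X by auto
    then show ?thesis using sX X by auto
  qed
  then obtain j where j: "\<forall>s\<in>#M. full d j s \<and> \<not> deep (j + 2) s" by blast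
  have "thin d t" by (rule optimal_thin[OF x opt d hole refl, where j = j]) (use j t in simp)
  then show ?thesis using bal adm unfolding greedy_shape_def by (auto simp: t)
qed

section \<open>Uniqueness of the greedy shape\<close>

lemma sum_mset_lower:
  fixes f :: "'a \<Rightarrow> nat"
  shows "\<forall>s\<in>#M. c \<le> f s \<Longrightarrow> size M * c \<le> (\<Sum>s\<in>#M. f s) \<and>
    ((\<Sum>s\<in>#M. f s) = size M * c \<longrightarrow> (\<forall>s\<in>#M. f s = c))"
  by (induction M) auto

lemma sum_mset_upper:
  fixes f :: "'a \<Rightarrow> nat"
  shows "\<forall>s\<in>#M. f s \<le> c \<Longrightarrow> (\<Sum>s\<in>#M. f s) \<le> size M * c \<and>
    ((\<Sum>s\<in>#M. f s) = size M * c \<longrightarrow> (\<forall>s\<in>#M. f s = c))"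
  by (induction M) auto

lemma nodes_pos: "nodes t > 0"
  by (cases t) simp

text \<open>With \<open>bounded_nodes\<close> this confines the branches belonging to
  \<open>j\<close> between two consecutive complete trees. The equality clauses make the bounds
  strict for incomplete branches and resolve the overlap between consecutive values of
  \<open>j\<close>.\<close>

lemma full_nodes:
  "full d j s \<Longrightarrow> nodes (complete_mtree d j) \<le> nodes s \<and> (nodes s = nodes (complete_mtree d j) \<longrightarrow> s
    = complete_mtree d j)"
proof (induction j arbitrary: s)
  case 0
  have "nodes (Node M) = 1 \<Longrightarrow> M = {#}" for M
    by (cases M) (auto simp: nodes_pos[THEN less_imp_neq, symmetric])
  then show ?case by (cases s) auto
next
  case (Suc j)
  obtain M where s: "s = Node M" by (cases s)
  have M: "size M = d" "\<forall>u\<in>#M. full d j u" using Suc.prems by (auto simp: s)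
  have low: "\<forall>u\<in>#M. nodes (complete_mtree d j) \<le> nodes u" using M Suc.IH by blast
  show ?case
  proof (intro conjI impI)
    show "nodes (complete_mtree d (Suc j)) \<le> nodes s"
      using sum_mset_lower[OF low, THEN conjunct1] M(1) by (simp add: s)
    assume "nodes s = nodes (complete_mtree d (Suc j))"
    then have "(\<Sum>u\<in>#M. nodes u) = size M * nodes (complete_mtree d j)" using M(1) by (simp add: s)
    then have "\<forall>u\<in>#M. nodes u = nodes (complete_mtree d j)"
      using sum_mset_lower[OF low, THEN conjunct2] by blast
    then have "\<forall>u\<in>#M. u = complete_mtree d j" using M Suc.IH by blast
    then have "M = replicate_mset d (complete_mtree d j)" using M(1) by (rule eq_replicate_mset)
    then show "s = complete_mtree d (Suc j)" by (simp add: s)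
  qed
qed

lemma bounded_nodes:
  "bounded_tree d s \<Longrightarrow> \<not> deep (Suc j) s \<Longrightarrow>
    nodes s \<le> nodes (complete_mtree d j) \<and> (nodes s = nodes (complete_mtree d j) \<longrightarrow> s =
      complete_mtree d j)"
proof (induction j arbitrary: s)
  case 0
  then have "s = complete_mtree d 0" by (intro full_eq_complete) auto
  then show ?case by simp
next
  case (Suc j)
  obtain M where s: "s = Node M" by (cases s)
  have M: "size M \<le> d" "\<forall>u\<in>#M. bounded_tree d u \<and> \<not> deep (Suc j) u" using Suc.prems
    by (auto simp: s)
  have up: "\<forall>u\<in>#M. nodes u \<le> nodes (complete_mtree d j)" using M Suc.IH by blast
  have le: "size M * nodes (complete_mtree d j) \<le> d * nodes (complete_mtree d j)" using M(1)
    by (rule mult_le_mono1)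
  show ?case
  proof (intro conjI impI)
    show "nodes s \<le> nodes (complete_mtree d (Suc j))"
      using order_trans[OF sum_mset_upper[OF up, THEN conjunct1] le] by (simp add: s)
    assume "nodes s = nodes (complete_mtree d (Suc j))"
    then have eq: "(\<Sum>u\<in>#M. nodes u) = d * nodes (complete_mtree d j)" by (simp add: s)
    then have "size M * nodes (complete_mtree d j) = d * nodes (complete_mtree d j)"
      using sum_mset_upper[OF up, THEN conjunct1] le eq by linarith
    then have sz: "size M = d" using nodes_pos[of "complete_mtree d j"] by simp
    then have "\<forall>u\<in>#M. nodes u = nodes (complete_mtree d j)"
      using sum_mset_upper[OF up, THEN conjunct2] eq unfolding sz by blast
    then have "\<forall>u\<in>#M. u = complete_mtree d j" using M Suc.IH by blast
    then have "M = replicate_mset d (complete_mtree d j)" using sz by (rule eq_replicate_mset)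
    then show "s = complete_mtree d (Suc j)" by (simp add: s)
  qed
qed

text \<open>What \<open>greedy_shape\<close> asks of each branch for a fixed \<open>j\<close>. The
  property passes from a branch to its child branches with \<open>j\<close> lowered by one, which
  makes uniqueness an induction.\<close>

definition near_complete :: "nat \<Rightarrow> nat \<Rightarrow> mtree \<Rightarrow> bool" where
  "near_complete d j s \<longleftrightarrow> bounded_tree d s \<and> full d j s \<and> \<not> deep (j + 2) s \<and> thin d s"

lemma full_complete_le: "0 < d \<Longrightarrow> full d k (complete_mtree d h) \<Longrightarrow> k \<le> h"
proof (induction k arbitrary: h)
  case (Suc k)
  then show ?case by (cases h) auto
qed simp

lemma deep_complete: "0 < d \<Longrightarrow> deep h (complete_mtree d h)"
  by (induction h) auto

lemma deep_mono: "k \<le> l \<Longrightarrow> deep l t \<Longrightarrow> deep k t"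
  by (induction l rule: dec_induct) (auto simp del: deep.simps dest: deep_antimono)

lemma near_complete_cases:
  assumes "0 < d" "near_complete d j s" "\<not> incomplete d s"
  shows "s = complete_mtree d j \<or> s = complete_mtree d (Suc j)"
proof -
  obtain h where s: "s = complete_mtree d h" using assms(3) by (auto simp: incomplete_def)
  have "j \<le> h" using full_complete_le assms(1,2) by (auto simp: near_complete_def s)
  moreover have "h < j + 2"
  proof (rule ccontr)
    assume "\<not> ?thesis"
    then show False using deep_mono[OF _ deep_complete[OF assms(1)], of "j + 2" h] assms(2)
      unfolding near_complete_def s by simp
  qed
  ultimately have "h = j \<or> h = Suc j" by linarith
  then show ?thesis using s by blast
qed

lemma near_complete_nodes:
  assumes "near_complete d j s" "incomplete d s"
  shows "nodes (complete_mtree d j) < nodes s \<and> nodes s < nodes (complete_mtree d (Suc j))"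
proof -
  have h: "s \<noteq> complete_mtree d h" for h using assms(2) by (simp add: incomplete_def)
  have "nodes (complete_mtree d j) \<le> nodes s \<and> nodes s \<noteq> nodes (complete_mtree d j)"
    using full_nodes[of d j s] assms(1) h[of j] unfolding near_complete_def by blast
  moreover have "nodes s \<le> nodes (complete_mtree d (Suc j))
    \<and> nodes s \<noteq> nodes (complete_mtree d (Suc j))"
    using bounded_nodes[of d s "Suc j"] assms(1) h[of "Suc j"] unfolding near_complete_def by simp
  ultimately show ?thesis by linarith
qed

lemma complete_split:
  assumes "0 < d"
  shows "\<forall>s\<in>#M. near_complete d j s \<Longrightarrow> \<exists>p q.
    M = replicate_mset p (complete_mtree d (Suc j)) + replicate_mset q (complete_mtree d j) +
      filter_mset (incomplete d) M"
proof (induction M)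
  case (add s M)
  then obtain p q where M: "M = replicate_mset p (complete_mtree d (Suc j))
    + replicate_mset q (complete_mtree d j) + filter_mset (incomplete d) M"
    by auto
  consider "incomplete d s" | "\<not> incomplete d s" "s = complete_mtree d j" | "\<not> incomplete d s" "s
    = complete_mtree d (Suc j)"
    using near_complete_cases[OF assms] add.prems by auto
  then show ?case
  proof cases
    case 1
    then have "add_mset s M = replicate_mset p (complete_mtree d (Suc j))
      + replicate_mset q (complete_mtree d j) + filter_mset (incomplete d) (add_mset s M)"
      by (subst M) (simp del: complete_mtree.simps)
    then show ?thesis by blast
  next
    case 2
    then have "add_mset s M = replicate_mset p (complete_mtree d (Suc j))
      + replicate_mset (Suc q) (complete_mtree d j) + filter_mset (incomplete d) (add_mset s M)"
      by (subst M) (simp del: complete_mtree.simps)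
    then show ?thesis by blast
  next
    case 3
    then have "add_mset s M = replicate_mset (Suc p) (complete_mtree d (Suc j))
      + replicate_mset q (complete_mtree d j) + filter_mset (incomplete d) (add_mset s M)"
      by (subst M) (simp del: complete_mtree.simps)
    then show ?thesis by blast
  qed
qed simp

lemma nodes_complete_less: "0 < d \<Longrightarrow> nodes (complete_mtree d j) < nodes (complete_mtree d (Suc j))"
  by (cases d) auto

text \<open>The excess of the total size over copies of the smaller complete tree is divided with remainder
  by the difference of the two complete sizes; the quotient counts the larger complete trees and the
  remainder fixes the incomplete one.\<close>

lemma near_complete_mset_unique:
  assumes d: "0 < d" and M: "\<forall>s\<in>#M. near_complete d j s" "size (filter_mset (incomplete d) M) \<le> 1"
    and M': "\<forall>s\<in>#M'. near_complete d j s" "size (filter_mset (incomplete d) M') \<le> 1"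
    and sz: "size M = size M'" and nd: "(\<Sum>s\<in>#M. nodes s) = (\<Sum>s\<in>#M'. nodes s)"
    and uniq: "\<And>s s'. near_complete d j s \<Longrightarrow> near_complete d j s' \<Longrightarrow> nodes s = nodes s' \<Longrightarrow> s = s'"
  shows "M = M'"
proof -
  define a c where "a = nodes (complete_mtree d j)" and "c = nodes (complete_mtree d (Suc j)) - a"
  have c: "nodes (complete_mtree d (Suc j)) = a + c" "c > 0" using nodes_complete_less[OF d, of j]
    by (auto simp: a_def c_def)
  \<comment> \<open>An incomplete branch has size strictly between the two complete sizes, so its
    excess satisfies \<open>0 < r < c\<close>; the value \<open>r = 0\<close> records that there is
    none.\<close>
  have ex: "\<exists>p q r I. L = replicate_mset p (complete_mtree d (Suc j))
    + replicate_mset q (complete_mtree d j) + I \<and>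
      (\<Sum>s\<in>#L. nodes s) = size L * a + (p * c + r) \<and> r < c \<and> size L = p + q + size I \<and>
      (I = {#} \<and> r = 0 \<or> (\<exists>s. I = {#s#} \<and> near_complete d j s \<and> nodes s = a + r \<and> r > 0))"
    if L: "\<forall>s\<in>#L. near_complete d j s" "size (filter_mset (incomplete d) L) \<le> 1" for L
  proof -
    define I where "I = filter_mset (incomplete d) L"
    obtain p q where pq: "L = replicate_mset p (complete_mtree d (Suc j))
      + replicate_mset q (complete_mtree d j) + I"
      using complete_split[OF d L(1)] unfolding I_def by blast
    have sL: "size L = p + q + size I" by (subst pq) (simp del: complete_mtree.simps)
    have nL: "(\<Sum>s\<in>#L. nodes s) = p * (a + c) + q * a + (\<Sum>s\<in>#I. nodes s)"
      by (subst pq) (simp del: complete_mtree.simps add: c a_def[symmetric])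
    show ?thesis
    proof (cases "I = {#}")
      case True
      have "(\<Sum>s\<in>#L. nodes s) = size L * a + (p * c + 0)" unfolding nL sL True
        by (simp add: algebra_simps)
      then show ?thesis using pq sL True c by blast
    next
      case False
      then obtain s where I: "I = {#s#}" using L(2) unfolding I_def[symmetric]
        by (metis One_nat_def le_Suc_eq le_zero_eq size_1_singleton_mset size_eq_0_iff_empty)
      have "s \<in># filter_mset (incomplete d) L" using I I_def
        by (metis union_single_eq_member add_mset_add_single)
      then have s: "near_complete d j s" "incomplete d s" using L(1) by auto
      define r where "r = nodes s - a"
      have r: "nodes s = a + r" "r > 0" "r < c"
        using near_complete_nodes[OF s] unfolding c(1) a_def[symmetric] r_def by auto
      have "(\<Sum>s\<in>#L. nodes s) = size L * a + (p * c + r)" unfolding nL sL I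
        by (simp add: r algebra_simps)
      then show ?thesis using pq sL I s(1) r by blast
    qed
  qed
  obtain p q r I where L: "M = replicate_mset p (complete_mtree d (Suc j))
    + replicate_mset q (complete_mtree d j) + I"
    "(\<Sum>s\<in>#M. nodes s) = size M * a + (p * c + r)" "r < c" "size M = p + q + size I"
    "I = {#} \<and> r = 0 \<or> (\<exists>s. I = {#s#} \<and> near_complete d j s \<and> nodes s = a + r \<and> r > 0)"
    using ex[OF M] by blast
  obtain p' q' r' I' where L': "M' = replicate_mset p' (complete_mtree d (Suc j))
    + replicate_mset q' (complete_mtree d j) + I'"
    "(\<Sum>s\<in>#M'. nodes s) = size M' * a + (p' * c + r')" "r' < c" "size M' = p' + q' + size I'"
    "I' = {#} \<and> r' = 0 \<or> (\<exists>s. I' = {#s#} \<and> near_complete d j s \<and> nodes s = a + r' \<and> r' > 0)"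
    using ex[OF M'] by blast
  have eq: "p * c + r = p' * c + r'" using L(2) L'(2) sz nd by simp
  have "p = p'" using arg_cong[OF eq, of "\<lambda>m. m div c"] L(3) L'(3) c by simp
  moreover have r: "r = r'" using eq \<open>p = p'\<close> by simp
  have "I = I'" using L(5) L'(5) uniq unfolding r by auto
  moreover have "q = q'" using L(4) L'(4) sz \<open>I = I'\<close> \<open>p = p'\<close> by simp
  ultimately show ?thesis using L(1) L'(1) by simp
qed

text \<open>The multiset lemma is applied to the child branches, with the induction hypothesis as
  its \<open>uniq\<close>. At \<open>j = 0\<close> the branches are stars, determined by their
  number of leaves.\<close>

lemma near_complete_unique:
  assumes "0 < d"
  shows "near_complete d j s \<Longrightarrow> near_complete d j s' \<Longrightarrow> nodes s = nodes s' \<Longrightarrow> s = s'"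
proof (induction j arbitrary: s s')
  case 0
  have *: "\<exists>m. u = Node (replicate_mset m (Node {#}))" if u: "near_complete d 0 u" for u
  proof -
    obtain M where M: "u = Node M" by (cases u)
    have "\<forall>v\<in>#M. \<not> deep (Suc 0) v" using u by (auto simp: near_complete_def M numeral_2_eq_2)
    then have "\<forall>v\<in>#M. v = complete_mtree d 0" using full_eq_complete[of d 0]
      by (metis full.simps(1))
    then have "M = replicate_mset (size M) (complete_mtree d 0)" using refl
      by (rule eq_replicate_mset)
    then show ?thesis using M by (metis complete_mtree.simps(1))
  qed
  from *[OF 0(1)] *[OF 0(2)] 0(3) show ?case by auto
next
  case (Suc j)
  obtain M M' where s: "s = Node M" "s' = Node M'" by (metis mtree.exhaust)
  have M: "size M = d" "\<forall>u\<in>#M. near_complete d j u" "size (filter_mset (incomplete d) M) \<le> 1"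
    using Suc.prems(1) by (auto simp: near_complete_def s)
  have M': "size M' = d" "\<forall>u\<in>#M'. near_complete d j u" "size (filter_mset (incomplete d) M') \<le> 1"
    using Suc.prems(2) by (auto simp: near_complete_def s)
  have "M = M'"
    by (rule near_complete_mset_unique[OF assms M(2,3) M'(2,3)]) (use M M' Suc s in auto)
  then show ?case by (simp add: s)
qed

text \<open>The number \<open>j\<close> is not determined by the tree: \<open>d + 1\<close> complete
  branches of height \<open>j + 1\<close> fit both \<open>j\<close> and \<open>j + 1\<close>. This
  is the only overlap. If \<open>j < j'\<close>, branches for \<open>j\<close> have at most the size
  of the complete tree of height \<open>j + 1\<close>, and branches for \<open>j'\<close> at least
  that of height \<open>j'\<close>; equal totals force equality throughout.\<close>

lemma greedy_shape_unique:
  assumes d: "0 < d" and t: "greedy_shape d t" "greedy_shape d t'" and n: "nodes t = nodes t'"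
  shows "t = t'"
proof -
  have shape: "\<exists>M j. u = Node M \<and> size M = d + 1 \<and> size (filter_mset (incomplete d) M) \<le> 1 \<and>
     (\<forall>s\<in>#M. near_complete d j s)" if "greedy_shape d u" for u
  proof -
    obtain M where "u = Node M" by (cases u)
    then show ?thesis using that by (auto simp: greedy_shape_def near_complete_def)
  qed
  have mono: "strict_mono (\<lambda>j. nodes (complete_mtree d j))"
    using nodes_complete_less[OF d] by (simp add: strict_mono_Suc_iff)
  have less: "u = u'" if j: "j < j'"
    and M: "u = Node M" "size M = d + 1" "\<forall>s\<in>#M. near_complete d j s"
     and M': "u' = Node M'" "size M' = d + 1" "\<forall>s\<in>#M'. near_complete d j' s"
       and nu: "nodes u = nodes u'"
    for u u' M M' j j'
  proof -
    have up: "\<forall>s\<in>#M. nodes s \<le> nodes (complete_mtree d (Suc j))"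
    proof
      fix s assume "s \<in># M"
      then have "bounded_tree d s" "\<not> deep (Suc (Suc j)) s" using M(3)
        by (auto simp: near_complete_def)
      then show "nodes s \<le> nodes (complete_mtree d (Suc j))" using bounded_nodes by blast
    qed
    have lo: "\<forall>s\<in>#M'. nodes (complete_mtree d j') \<le> nodes s"
      using M'(3) full_nodes unfolding near_complete_def by blast
    have le: "nodes (complete_mtree d (Suc j)) \<le> nodes (complete_mtree d j')"
      using strict_mono_less_eq[OF mono, of "Suc j" j'] j by simp
    have "(d + 1) * nodes (complete_mtree d (Suc j)) \<le> (d + 1) * nodes (complete_mtree d j')"
      using le by (rule mult_le_mono2)
    moreover have e: "(\<Sum>s\<in>#M. nodes s) = (\<Sum>s\<in>#M'. nodes s)" using nu M M' by simp
    ultimately have E: "(\<Sum>s\<in>#M. nodes s) = (d + 1) * nodes (complete_mtree d (Suc j))"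
       "(\<Sum>s\<in>#M'. nodes s) = (d + 1) * nodes (complete_mtree d j')"
       "(d + 1) * nodes (complete_mtree d (Suc j)) = (d + 1) * nodes (complete_mtree d j')"
      using sum_mset_upper[OF up, THEN conjunct1] sum_mset_lower[OF lo, THEN conjunct1]
      unfolding M(2) M'(2) by linarith+
    have "nodes (complete_mtree d (Suc j)) = nodes (complete_mtree d j')" using E(3)
      by (metis mult_cancel1 add_is_0 one_neq_zero)
    then have j': "j' = Suc j" using strict_mono_eq[OF mono, of "Suc j" j'] by simp
    have "\<forall>s\<in>#M. nodes s = nodes (complete_mtree d (Suc j))"
      using sum_mset_upper[OF up, THEN conjunct2] E(1) unfolding M(2) by blast
    moreover have "bounded_tree d s \<and> \<not> deep (Suc (Suc j)) s" if "s \<in># M" for s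
      using M(3) that by (simp add: near_complete_def)
    ultimately have "\<forall>s\<in>#M. s = complete_mtree d (Suc j)" using bounded_nodes by blast
    moreover have "\<forall>s\<in>#M'. nodes s = nodes (complete_mtree d j')"
      using sum_mset_lower[OF lo, THEN conjunct2] E(2) unfolding M'(2) by blast
    then have "\<forall>s\<in>#M'. s = complete_mtree d j'"
      using M'(3) full_nodes unfolding near_complete_def by blast
    ultimately have "M = replicate_mset (d + 1) (complete_mtree d (Suc j))" "M' = replicate_mset (d
      + 1) (complete_mtree d j')"
      using M(2) M'(2) by (blast intro: eq_replicate_mset)+
    then show ?thesis using M(1) M'(1) j' by simp
  qed
  obtain M j where M: "t = Node M" "size M = d + 1" "size (filter_mset (incomplete d) M) \<le> 1"
    "\<forall>s\<in>#M. near_complete d j s"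
    using shape[OF t(1)] by blast
  obtain M' j' where M': "t' = Node M'" "size M' = d + 1" "size (filter_mset (incomplete d) M') \<le> 1"
    "\<forall>s\<in>#M'. near_complete d j' s"
    using shape[OF t(2)] by blast
  consider "j < j'" | "j' < j" | "j = j'" by linarith
  then show ?thesis
  proof cases
    case 1
    show ?thesis by (rule less[OF 1 M(1,2,4) M'(1,2,4) n])
  next
    case 2
    show ?thesis by (rule less[OF 2 M'(1,2,4) M(1,2,4) n[symmetric], symmetric])
  next
    case 3
    have "M = M'"
      by (rule near_complete_mset_unique[OF d M(4,3) _ M'(3)])
        (use M M' n 3 near_complete_unique[OF d] in auto)
    then show ?thesis using M M' by simp
  qed
qed

section \<open>Existence of minimisers\<close>

lemma finite_nodes_le: "finite {t. nodes t \<le> n}"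
proof (induction n)
  case 0
  have "{t. nodes t \<le> 0} = {}" using nodes_pos by (auto simp: not_le)
  then show ?case by (simp del: le_zero_eq)
next
  case (Suc n)
  have "{t. nodes t \<le> Suc n} \<subseteq> (\<lambda>xs. Node (mset xs)) ` {xs. set xs \<subseteq> {t. nodes t \<le> n}
    \<and> length xs \<le> n}"
  proof
    fix t assume t: "t \<in> {t. nodes t \<le> Suc n}"
    obtain M where M: "t = Node M" by (cases t)
    obtain xs where xs: "M = mset xs" by (metis ex_mset)
    have le: "(\<Sum>s\<in>#M. nodes s) \<le> n" using t by (simp add: M)
    have "length xs \<le> n"
      using sum_mset_lower[of M 1 nodes] nodes_pos le unfolding xs by (simp add: Suc_le_eq)
    moreover have "nodes s \<le> n" if "s \<in># M" for s
      using multi_member_split[OF that] le by auto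
    ultimately show "t \<in> (\<lambda>xs. Node (mset xs)) ` {xs. set xs \<subseteq> {t. nodes t \<le> n} \<and> length xs \<le> n}"
      using M xs by auto
  qed
  moreover have "finite {xs. set xs \<subseteq> {t. nodes t \<le> n} \<and> length xs \<le> n}"
    using Suc by (rule finite_lists_length_le)
  ultimately show ?case by (meson finite_imageI finite_subset)
qed

lemma ex_admissible:
  assumes "0 < d"
  shows "\<exists>t. admissible d t \<and> nodes t = Suc m"
proof -
  have "\<exists>t. bounded_tree d t \<and> nodes t = Suc m"
  proof (induction m)
    case 0
    show ?case by (rule exI[of _ "Node {#}"]) simp
  next
    case (Suc m)
    then obtain t where "bounded_tree d t" "nodes t = Suc m" by blast
    then show ?case using assms by (intro exI[of _ "Node {#t#}"]) simp
  qed
  then obtain t where t: "bounded_tree d t" "nodes t = Suc m" by blast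
  have "admissible d t" using t by (cases t) (auto simp: admissible_def)
  then show ?thesis using t by blast
qed

lemma optimal_rotate:
  assumes x: "x > 0" and opt: "optimal d x (Node (add_mset (Node Y) X))"
  shows "optimal d x (Node (add_mset (Node X) Y)) \<and>
    nodes (Node (add_mset (Node X) Y)) = nodes (Node (add_mset (Node Y) X))"
proof -
  have adm: "admissible d (Node (add_mset (Node Y) X))" using opt by (simp add: optimal_def)
  then have s: "size Y \<le> d" "size X \<le> d" by (auto simp: admissible_def)
  have "admissible d (Node (add_mset (Node X) Y))" using adm s by (auto simp: admissible_def)
  moreover have n: "nodes (Node (add_mset (Node X) Y)) = nodes (Node (add_mset (Node Y) X))" by simp
  moreover have "phi x (Node (add_mset (Node X) Y)) = phi x (Node (add_mset (Node Y) X))"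
    using phi_join[OF x, of "Node X" "Node Y"] phi_join[OF x, of "Node Y" "Node X"]
      by (simp add: mult_ac)
  ultimately show ?thesis using opt unfolding optimal_def by metis
qed

text \<open>Among all minimisers with \<open>n\<close> nodes, one with the largest root conductance
  is taken. Moving its root across an edge gives another minimiser, which is the hypothesis
  \<open>rot\<close> of \<open>optimal_greedy_shape\<close>.\<close>

lemma ex_optimal_greedy_shape:
  assumes x: "x > 0" and d: "0 < d" and n: "n \<ge> d + 2"
  shows "\<exists>t. optimal d x t \<and> nodes t = n \<and> greedy_shape d t"
proof -
  have fin: "finite {t. P t \<and> nodes t = n}" for P
    by (rule finite_subset[OF _ finite_nodes_le[of n]]) auto
  define A where "A = {t. admissible d t \<and> nodes t = n}"
  have A: "finite A" "A \<noteq> {}" using fin ex_admissible[OF d, of "n - 1"] n by (auto simp: A_def)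
  obtain t0 where t0: "t0 \<in> A" "\<And>t. t \<in> A \<Longrightarrow> phi x t0 \<le> phi x t"
    using arg_min_if_finite[OF A, of "phi x"] by (metis not_le)
  define B where "B = {t. optimal d x t \<and> nodes t = n}"
  have "t0 \<in> B" using t0 unfolding A_def B_def optimal_def by auto
  then have B: "finite B" "B \<noteq> {}" using fin by (auto simp: B_def)
  obtain t where t: "t \<in> B" "\<And>t'. t' \<in> B \<Longrightarrow> tau x t' \<le> tau x t"
    using arg_min_if_finite[OF B, of "\<lambda>t. - tau x t"] by (metis neg_less_iff_less not_le)
  have opt: "optimal d x t" "nodes t = n" using t(1) by (auto simp: B_def)
  have "greedy_shape d t"
  proof (rule optimal_greedy_shape[OF x d opt(1)])
    show "d + 2 \<le> nodes t" using opt n by simp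
    fix X Y assume e: "t = Node (add_mset (Node Y) X)"
    show "tau x (Node (add_mset (Node X) Y)) \<le> tau x t"
      by (rule t(2)) (use optimal_rotate[OF x, of d Y X] opt in \<open>simp add: e B_def\<close>)
  qed
  then show ?thesis using opt by blast
qed

lemma greedy_shape_optimal:
  assumes "x > 0" "0 < d" "greedy_shape d t" "nodes t \<ge> d + 2"
  shows "optimal d x t"
proof -
  obtain t' where "optimal d x t'" "nodes t = nodes t'" "greedy_shape d t'"
    using ex_optimal_greedy_shape[OF assms(1,2,4)] by metis
  then show ?thesis using greedy_shape_unique[OF assms(2,3)] by metis
qed

section \<open>Rooted structure of graphs\<close>

definition adj :: "'a ugraph \<Rightarrow> ('a \<times> 'a) set" where
  "adj G = {(u, v). u \<in> verts G \<and> v \<in> verts G \<and> {u, v} \<in> edges G}"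

lemma adj_sym: "(u, v) \<in> adj G \<Longrightarrow> (v, u) \<in> adj G"
  by (auto simp: adj_def insert_commute)

lemma path_betweenI: "p \<noteq> [] \<Longrightarrow> distinct p \<Longrightarrow> set p \<subseteq> verts G \<Longrightarrow>
    successively (\<lambda>u v. {u, v} \<in> edges G) p \<Longrightarrow> hd p = u \<Longrightarrow> last p = v \<Longrightarrow> path_between G u v p"
  by (simp add: path_between_def graph_path_def)

lemma rtrancl_adj_path:
  assumes "(u, v) \<in> (adj G)\<^sup>*" "u \<in> verts G"
  shows "\<exists>p. path_between G u v p"
  using assms(1)
proof (induction rule: rtrancl_induct)
  case base
  show ?case by (rule exI[of _ "[u]"]) (use assms in \<open>simp add: path_between_def graph_path_def\<close>)
next
  case (step v w)
  then obtain p where p: "p \<noteq> []" "distinct p" "set p \<subseteq> verts G"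
    "successively (\<lambda>u v. {u, v} \<in> edges G) p" "hd p = u" "last p = v"
    by (auto simp: path_between_def graph_path_def)
  show ?case
  proof (cases "w \<in> set p")
    case True
    then obtain xs ys where xs: "p = xs @ w # ys" by (meson split_list)
    show ?thesis
      by (rule exI[of _ "xs @ [w]"], rule path_betweenI)
        (use p in \<open>auto simp: xs successively_append_iff hd_append\<close>)
  next
    case False
    show ?thesis
      by (rule exI[of _ "p @ [w]"], rule path_betweenI)
        (use p False step(2) in \<open>auto simp: successively_append_iff adj_def\<close>)
  qed
qed

lemma successively_rtrancl:
  "successively (\<lambda>u v. (u, v) \<in> R) p \<Longrightarrow> p \<noteq> [] \<Longrightarrow> (hd p, last p) \<in> R\<^sup>*"
  by (induction p rule: induct_list012) (auto intro: converse_rtrancl_into_rtrancl)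

lemma path_rtrancl_adj:
  assumes "path_between G u v p"
  shows "(u, v) \<in> (adj G)\<^sup>*"
proof -
  have "successively (\<lambda>u v. {u, v} \<in> edges G) p"
    using assms by (auto simp: path_between_def graph_path_def)
  then have "successively (\<lambda>u v. (u, v) \<in> adj G) p"
    by (rule successively_mono) (use assms in \<open>auto simp: path_between_def graph_path_def adj_def\<close>)
  then show ?thesis
    using successively_rtrancl[of "adj G" p] assms by (auto simp: path_between_def graph_path_def)
qed

text \<open>A rooted tree is given by a parent map instead of paths; \<open>dep\<close> certifies
  that iterating \<open>par\<close> ends at \<open>r\<close>. The value \<open>par r\<close> is left
  free. The path-based notions are translated into this language inside the locale.\<close>

locale parented =
  fixes G :: "'a ugraph" and r :: 'a and par :: "'a \<Rightarrow> 'a" and dep :: "'a \<Rightarrow> nat"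
  assumes finite_verts: "finite (verts G)"
    and root_in: "r \<in> verts G" and dep_root: "dep r = 0"
    and par_in: "\<And>v. v \<in> verts G \<Longrightarrow> v \<noteq> r \<Longrightarrow> par v \<in> verts G"
    and dep_par: "\<And>v. v \<in> verts G \<Longrightarrow> v \<noteq> r \<Longrightarrow> dep v = Suc (dep (par v))"
    and edges_eq: "edges G = (\<lambda>v. {v, par v}) ` (verts G - {r})"
begin

definition ch :: "'a \<Rightarrow> 'a set" where
  "ch v = {u \<in> verts G. u \<noteq> r \<and> par u = v}"

definition below :: "('a \<times> 'a) set" where
  "below = (\<lambda>u. (par u, u)) ` (verts G - {r})"

definition desc :: "'a \<Rightarrow> 'a set" where
  "desc v = {w. (v, w) \<in> below\<^sup>*}"

lemma finite_ch [simp]: "finite (ch v)"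
  using finite_verts by (simp add: ch_def)

lemma below_iff: "(v, u) \<in> below \<longleftrightarrow> u \<in> ch v"
  by (auto simp: below_def ch_def)

lemma ch_subset: "ch v \<subseteq> verts G"
  by (auto simp: ch_def)

lemma dep_ch: "u \<in> ch v \<Longrightarrow> dep u = Suc (dep v)"
  using dep_par by (auto simp: ch_def)

lemma desc_refl [simp]: "v \<in> desc v"
  by (simp add: desc_def)

lemma desc_step: "w \<in> desc v \<Longrightarrow> u \<in> ch w \<Longrightarrow> u \<in> desc v"
  by (auto simp: desc_def below_iff[symmetric] intro: rtrancl_into_rtrancl)

lemma desc_trans: "w \<in> desc v \<Longrightarrow> u \<in> desc w \<Longrightarrow> u \<in> desc v"
  by (auto simp: desc_def)

lemma desc_cases:
  assumes "w \<in> desc v"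
  obtains "w = v" | "w \<in> verts G" "w \<noteq> r" "par w \<in> desc v" "w \<in> ch (par w)"
  using assms unfolding desc_def by (auto simp: below_iff ch_def elim: rtranclE)

lemma desc_subset: "v \<in> verts G \<Longrightarrow> desc v \<subseteq> verts G"
proof
  fix w assume v: "v \<in> verts G" and "w \<in> desc v"
  from this(2) show "w \<in> verts G" by (cases rule: desc_cases) (use v in auto)
qed

lemma finite_desc: "v \<in> verts G \<Longrightarrow> finite (desc v)"
  using desc_subset finite_verts finite_subset by blast

lemma dep_desc: "w \<in> desc v \<Longrightarrow> dep v \<le> dep w"
  unfolding desc_def mem_Collect_eq
  by (induction rule: rtrancl_induct) (auto simp: below_iff dest: dep_ch)

lemma desc_eq: "desc v = insert v (\<Union>c\<in>ch v. desc c)"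
proof -
  have "w \<in> insert v (\<Union>c\<in>ch v. desc c)" if "(v, w) \<in> below\<^sup>*" for w
    using that by (cases rule: converse_rtranclE) (auto simp: desc_def below_iff)
  moreover have "w \<in> desc v" if "c \<in> ch v" "w \<in> desc c" for w c
    using that by (meson desc_refl desc_step desc_trans)
  ultimately show ?thesis by (auto simp: desc_def)
qed

lemma ancestor_unique: "w \<in> desc a \<Longrightarrow> w \<in> desc b \<Longrightarrow> dep a = dep b \<Longrightarrow> a = b"
proof (induction "dep w" arbitrary: w rule: less_induct)
  case less
  from less.prems(1) show ?case
  proof (cases rule: desc_cases)
    case 1
    from less.prems(2) show ?thesis
    proof (cases rule: desc_cases)
      case 2
      then show ?thesis using dep_desc[OF 2(3)] dep_par[of w] 1 less.prems by simp
    qed (use 1 in simp)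
  next
    case 2
    from less.prems(2) show ?thesis
    proof (cases rule: desc_cases)
      case 1
      then show ?thesis using dep_desc[OF 2(3)] dep_par[of w] 2 less.prems by simp
    next
      case 2
      then show ?thesis using less.hyps[of "par w"] dep_par[of w] \<open>par w \<in> desc a\<close> less.prems
        by simp
    qed
  qed
qed

lemma desc_disjoint: "c \<in> ch v \<Longrightarrow> c' \<in> ch v \<Longrightarrow> c \<noteq> c' \<Longrightarrow> desc c \<inter> desc c' = {}"
  using ancestor_unique dep_ch by (metis disjoint_iff)

lemma self_notin_desc_ch: "c \<in> ch v \<Longrightarrow> v \<notin> desc c"
  using dep_desc dep_ch by fastforce

lemma tree_induct [consumes 1, case_names step]:
  assumes "v \<in> verts G" and "\<And>v. v \<in> verts G \<Longrightarrow> (\<And>c. c \<in> ch v \<Longrightarrow> P c) \<Longrightarrow> P v"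
  shows "P v"
proof -
  define H where "H = Max (dep ` verts G)"
  have H: "dep w \<le> H" if "w \<in> verts G" for w using that finite_verts by (simp add: H_def)
  show ?thesis using assms(1)
  proof (induction "H - dep v" arbitrary: v rule: less_induct)
    case less
    show ?case
    proof (rule assms(2)[OF less.prems])
      fix c assume c: "c \<in> ch v"
      then have "c \<in> verts G" using ch_subset by blast
      then show "P c" using less.hyps[of c] dep_ch[OF c] H[of c] by simp
    qed
  qed
qed

lemma desc_root: "desc r = verts G"
proof
  show "desc r \<subseteq> verts G" using desc_subset root_in .
  show "verts G \<subseteq> desc r"
  proof
    fix v assume "v \<in> verts G"
    then show "v \<in> desc r"
    proof (induction "dep v" arbitrary: v rule: less_induct)
      case less
      show ?case
      proof (cases "v = r")
        case False
        then have "par v \<in> desc r" using less par_in dep_par by simp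
        moreover have "v \<in> ch (par v)" using False less.prems by (simp add: ch_def)
        ultimately show ?thesis by (rule desc_step)
      qed simp
    qed
  qed
qed

lemma par_neq: "v \<in> verts G \<Longrightarrow> v \<noteq> r \<Longrightarrow> par v \<noteq> v"
  using dep_par by (metis n_not_Suc_n)

lemma edge_iff: "{u, v} \<in> edges G \<longleftrightarrow> u \<in> ch v \<or> v \<in> ch u"
proof -
  have "{u, v} = {w, par w} \<longleftrightarrow> (u = w \<and> v = par w) \<or> (v = w \<and> u = par w)" for w
    by (auto simp: doubleton_eq_iff)
  then show ?thesis unfolding edges_eq ch_def image_iff by auto
qed

lemma edge_in_verts: "{u, v} \<in> edges G \<Longrightarrow> u \<in> verts G \<and> v \<in> verts G"
  using par_in by (auto simp: edge_iff ch_def)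

lemma adj_iff: "(u, v) \<in> adj G \<longleftrightarrow> u \<in> ch v \<or> v \<in> ch u"
  using edge_in_verts by (auto simp: adj_def edge_iff)

lemma below_subset_adj: "below \<subseteq> adj G"
  by (auto simp: adj_iff below_iff)

lemma simple_G: "simple_graph G"
  unfolding simple_graph_def edges_eq
  using finite_verts par_in par_neq by (auto simp: card_2_iff doubleton_eq_iff)

lemma root_connected: "v \<in> verts G \<Longrightarrow> (r, v) \<in> (adj G)\<^sup>*"
  using desc_root rtrancl_mono[OF below_subset_adj] by (auto simp: desc_def)

lemma connected_G: "connected_graph G"
  unfolding connected_graph_def
proof (intro conjI ballI)
  show "verts G \<noteq> {}" using root_in by blast
  fix u v assume uv: "u \<in> verts G" "v \<in> verts G"
  have "sym (adj G)" by (rule symI) (rule adj_sym)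
  then have "(u, r) \<in> (adj G)\<^sup>*"
    by (rule symD[OF sym_rtrancl _ , OF _ root_connected[OF uv(1)]])
  then have "(u, v) \<in> (adj G)\<^sup>*" using root_connected[OF uv(2)] by (rule rtrancl_trans)
  then show "\<exists>p. path_between G u v p" using uv(1) by (rule rtrancl_adj_path)
qed

text \<open>Both cycle neighbours of a deepest vertex of a cycle would be its parent.\<close>

lemma no_cycle: "\<not> graph_cycle G p"
proof
  assume c: "graph_cycle G p"
  then have p: "distinct p" "set p \<subseteq> verts G" "length p \<ge> 3" "{last p, hd p} \<in> edges G"
    and s: "successively (\<lambda>u v. {u, v} \<in> edges G) p" "p \<noteq> []"
    by (auto simp: graph_cycle_def graph_path_def)
  define k where "k = length p"
  have step: "{p ! i, p ! (Suc i mod k)} \<in> edges G" if "i < k" for i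
  proof (cases "Suc i < k")
    case True
    then show ?thesis using s by (simp add: successively_conv_nth k_def)
  next
    case False
    then have "Suc i = k" using that by simp
    then show ?thesis using p(4) s(2)
      by (simp add: last_conv_nth hd_conv_nth k_def[symmetric] flip: \<open>Suc i = k\<close>)
  qed
  obtain i where i: "i < k" "\<And>j. j < k \<Longrightarrow> dep (p ! j) \<le> dep (p ! i)"
  proof -
    have "finite ((\<lambda>i. dep (p ! i)) ` {..<k})" "(\<lambda>i. dep (p ! i)) ` {..<k} \<noteq> {}"
      using p(3) s(2) by (auto simp: k_def lessThan_empty_iff bot_nat_def)
    from Max_in[OF this] Max_ge[OF this(1)] show ?thesis using that by fastforce
  qed
  have nb: "p ! j = par (p ! i)" if "j < k" "{p ! i, p ! j} \<in> edges G" for j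
    using that(2) i(2)[OF that(1)] dep_ch[of "p ! j" "p ! i"] by (auto simp: edge_iff ch_def)
  \<comment> \<open>The cyclic successor and predecessor of position \<open>i\<close>; they differ
    because \<open>k\<close> is at least 3.\<close>
  define a b where "a = Suc i mod k" and "b = (if i = 0 then k - 1 else i - 1)"
  have k3: "k \<ge> 3" using p(3) by (simp add: k_def)
  have ab: "a < k" "b < k" using i(1) k3 by (auto simp: a_def b_def)
  have "Suc b mod k = i" using i(1) k3 by (auto simp: b_def)
  then have "{p ! i, p ! b} \<in> edges G" using step[OF ab(2)] by (simp add: insert_commute)
  then have "p ! b = par (p ! i)" by (rule nb[OF ab(2)])
  moreover have "p ! a = par (p ! i)" using nb[OF ab(1)] step[OF i(1)] by (simp add: a_def)
  ultimately have "a = b" using p(1) ab by (metis k_def nth_eq_iff_index_eq)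
  then show False using i(1) k3 by (auto simp: a_def b_def mod_Suc split: if_splits)
qed

lemma tree_G: "tree G"
  using simple_G connected_G no_cycle by (auto simp: tree_def)

lemma neighbours_eq: "v \<in> verts G \<Longrightarrow> neighbours G v = (if v
  = r then ch v else insert (par v) (ch v))"
  using par_in ch_subset by (auto simp: neighbours_def edge_iff ch_def)

lemma vdegree_eq: "v \<in> verts G \<Longrightarrow> vdegree G v = (if v = r then card (ch v) else Suc (card (ch v)))"
proof -
  assume v: "v \<in> verts G"
  have "par v \<notin> ch v" if "v \<noteq> r" using dep_ch[of "par v" v] dep_par[OF v that] by auto
  then show ?thesis using v by (auto simp: vdegree_def neighbours_eq)
qed

text \<open>A path from the root can only descend: a step to the parent would return to the
  preceding vertex of the path, which distinctness forbids.\<close>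

lemma root_path_nth:
  assumes p: "graph_path G p" "hd p = r"
  shows "i < length p \<Longrightarrow> dep (p ! i) = i \<and> (i > 0 \<longrightarrow> p ! i \<in> ch (p ! (i - 1)))"
proof (induction i rule: less_induct)
  case (less i)
  have ne: "p \<noteq> []" using p by (simp add: graph_path_def)
  show ?case
  proof (cases i)
    case 0
    then show ?thesis using p(2) ne dep_root by (simp add: hd_conv_nth)
  next
    case (Suc j)
    have "{p ! j, p ! i} \<in> edges G" using p(1) less.prems Suc
      by (auto simp: graph_path_def successively_conv_nth)
    moreover have "p ! j \<notin> ch (p ! i)"
    proof
      assume c: "p ! j \<in> ch (p ! i)"
      then have "j > 0" using c p(2) ne by (cases j) (auto simp: ch_def hd_conv_nth)
      then have "p ! j \<in> ch (p ! (j - 1))" using less.IH[of j] less.prems Suc by simp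
      then have "p ! (j - 1) = p ! i" using c by (simp add: ch_def)
      then show False using p(1) less.prems Suc \<open>j > 0\<close>
        by (simp add: graph_path_def nth_eq_iff_index_eq)
    qed
    ultimately have "p ! i \<in> ch (p ! j)" by (simp add: edge_iff)
    then show ?thesis using dep_ch less.IH[of j] less.prems Suc by simp
  qed
qed

lemma root_path_desc:
  assumes p: "graph_path G p" "hd p = r" and "i \<le> j" "j < length p"
  shows "p ! j \<in> desc (p ! i)"
  using assms(3,4)
proof (induction j rule: dec_induct)
  case (step j)
  then show ?case using root_path_nth[OF p, of "Suc j"] by (auto intro: desc_step)
qed simp

lemma root_path_length:
  assumes "path_between G r w p"
  shows "length p = Suc (dep w)"
proof -
  have p: "graph_path G p" "hd p = r" "last p = w" "p \<noteq> []"
    using assms by (auto simp: path_between_def graph_path_def)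
  then show ?thesis using root_path_nth[OF p(1,2), of "length p - 1"] by (auto simp: last_conv_nth)
qed

lemma ex_root_path: "w \<in> verts G \<Longrightarrow> \<exists>p. path_between G r w p"
  using connected_G root_in by (simp add: connected_graph_def)

lemma gdist_eq: "w \<in> verts G \<Longrightarrow> gdist G r w = dep w"
  unfolding gdist_def
proof (rule Least_equality)
  assume "w \<in> verts G"
  then obtain p where "path_between G r w p" using ex_root_path by blast
  then show "\<exists>p. path_between G r w p \<and> length p = Suc (dep w)" using root_path_length by blast
next
  fix k assume "\<exists>p. path_between G r w p \<and> length p = Suc k"
  then show "dep w \<le> k" using root_path_length by fastforce
qed

lemma descendants_eq: "u \<in> verts G \<Longrightarrow> descendants G r u = desc u"
proof (intro equalityI subsetI)
  fix w assume "w \<in> descendants G r u"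
  then obtain p where p: "path_between G r w p" "u \<in> set p" by (auto simp: descendants_def)
  then have p': "graph_path G p" "hd p = r" "last p = w" "p \<noteq> []"
    by (auto simp: path_between_def graph_path_def)
  obtain i where "i < length p" "p ! i = u" using p(2) by (auto simp: in_set_conv_nth)
  then show "w \<in> desc u" using root_path_desc[OF p'(1,2), of i "length p - 1"] p'
    by (simp add: last_conv_nth)
next
  fix w assume u: "u \<in> verts G" and w: "w \<in> desc u"
  then have "w \<in> verts G" using desc_subset by blast
  then obtain p where p: "path_between G r w p" using ex_root_path by blast
  then have p': "graph_path G p" "hd p = r" "last p = w" "p \<noteq> []"
    by (auto simp: path_between_def graph_path_def)
  have l: "dep u < length p" using root_path_length[OF p] dep_desc[OF w] by simp
  \<comment> \<open>Both \<open>u\<close> and the vertex at position \<open>dep u\<close> of the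
    root path are ancestors of \<open>w\<close>, and they have the same depth.\<close>
  then have "w \<in> desc (p ! dep u)"
    using root_path_desc[OF p'(1,2), of "dep u" "length p - 1"] p' by (simp add: last_conv_nth)
  then have "p ! dep u = u" using ancestor_unique[OF _ w] root_path_nth[OF p'(1,2) l] by blast
  then have "u \<in> set p" using l by (metis nth_mem)
  then show "w \<in> descendants G r u" using p by (auto simp: descendants_def)
qed

lemma children_eq:
  assumes v: "v \<in> verts G"
  shows "children G r v = ch v"
proof -
  have "par v \<notin> desc v" if "v \<noteq> r" using dep_desc[of "par v" v] dep_par[OF v that] by auto
  moreover have "ch v \<subseteq> desc v" using desc_step[OF desc_refl] by blast
  ultimately show ?thesis using v
    by (auto simp: children_def neighbours_eq descendants_eq split: if_splits)
qed

text \<open>The parent map serves the subtree unchanged and only the depth shifts. As the sets of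
  children agree too, shapes assigned to vertices can be reused in the subtree.\<close>

lemma parented_subtree:
  assumes u: "u \<in> verts G"
  shows "parented (subtree_at G r u) u par (\<lambda>v. dep v - dep u)"
    and "\<And>v. v \<in> desc u \<Longrightarrow> parented.ch (subtree_at G r u) u par v = ch v"
proof -
  have V: "verts (subtree_at G r u) = desc u"
    by (simp add: subtree_at_def induced_def descendants_eq u)
  have in_desc: "v \<in> verts G \<and> v \<noteq> r \<and> par v \<in> desc u" if "v \<in> desc u" "v \<noteq> u" for v
    using that(1) by (cases rule: desc_cases) (use that in auto)
  have par_notin: "par u \<notin> desc u" if "u \<noteq> r"
    using dep_desc[of "par u" u] dep_par[OF u that] by auto
  show *: "parented (subtree_at G r u) u par (\<lambda>v. dep v - dep u)"
  proof
    show "finite (verts (subtree_at G r u))" using finite_desc[OF u] by (simp add: V)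
    show "edges (subtree_at G r u) = (\<lambda>v. {v, par v}) ` (verts (subtree_at G r u) - {u})"
      unfolding V using in_desc par_notin
      by (auto simp: subtree_at_def induced_def descendants_eq u edges_eq)
    fix v assume v: "v \<in> verts (subtree_at G r u)" "v \<noteq> u"
    then have "v \<in> verts G \<and> v \<noteq> r \<and> par v \<in> desc u" using in_desc by (simp add: V)
    then show "par v \<in> verts (subtree_at G r u)" "dep v - dep u = Suc (dep (par v) - dep u)"
      using dep_par[of v] dep_desc[of "par v" u] by (auto simp: V)
  qed (auto simp: V)
  fix v assume v: "v \<in> desc u"
  show "parented.ch (subtree_at G r u) u par v = ch v"
    unfolding parented.ch_def[OF *] V
  proof (intro equalityI subsetI)
    fix w assume "w \<in> {w \<in> desc u. w \<noteq> u \<and> par w = v}"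
    then show "w \<in> ch v" using in_desc[of w] by (simp add: ch_def)
  next
    fix w assume w: "w \<in> ch v"
    then have "w \<noteq> u" using v par_notin by (auto simp: ch_def)
    then show "w \<in> {w \<in> desc u. w \<noteq> u \<and> par w = v}" using w desc_step[OF v w] by (simp add: ch_def)
  qed
qed

end

text \<open>\<open>S v\<close> is the unlabelled shape of the branch at \<open>v\<close>. Being a
  parameter with a recursion equation, one and the same \<open>S\<close> serves a graph and all its
  subtrees; \<open>ex_rooted\<close> provides it.\<close>

locale rooted = parented +
  fixes S :: "'a \<Rightarrow> mtree"
  assumes S_eq: "\<And>v. v \<in> verts G \<Longrightarrow> S v = Node (image_mset S (mset_set (ch v)))"
begin

lemma ch_in: "u \<in> ch v \<Longrightarrow> u \<in> verts G"
  using ch_subset by blast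

lemma subtrees_S: "v \<in> verts G \<Longrightarrow> set_mset (subtrees (S v)) = S ` ch v"
  by (subst S_eq) auto

lemma size_S: "v \<in> verts G \<Longrightarrow> size (subtrees (S v)) = card (ch v)"
  by (subst S_eq) auto

lemma size_filter_S: "v \<in> verts G \<Longrightarrow> size (filter_mset P (subtrees (S v)))
  = card {u \<in> ch v. P (S u)}"
  by (subst S_eq) (auto simp: filter_mset_image_mset)

lemma nodes_S: "v \<in> verts G \<Longrightarrow> nodes (S v) = card (desc v)"
proof (induction rule: tree_induct)
  case (step v)
  have "card (desc v) = Suc (card (\<Union>c\<in>ch v. desc c))"
    using self_notin_desc_ch finite_desc ch_in by (subst desc_eq) (subst card_insert_disjoint, auto)
  also have "card (\<Union>c\<in>ch v. desc c) = (\<Sum>c\<in>ch v. card (desc c))"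
    using finite_desc ch_in desc_disjoint by (intro card_UN_disjoint) auto
  also have "\<dots> = (\<Sum>c\<in>ch v. nodes (S c))"
    using step(2) by (intro sum.cong) auto
  finally show ?case using step(1)
    by (subst S_eq) (auto simp: image_mset.compositionality comp_def sum_unfold_sum_mset)
qed

lemma ball_desc: "(\<forall>w\<in>desc v. P w) \<longleftrightarrow> P v \<and> (\<forall>c\<in>ch v. \<forall>w\<in>desc c. P w)"
  by (subst desc_eq) auto

lemma bex_desc: "(\<exists>w\<in>desc v. P w) \<longleftrightarrow> P v \<or> (\<exists>c\<in>ch v. \<exists>w\<in>desc c. P w)"
  by (subst desc_eq) auto

lemma deep_S: "v \<in> verts G \<Longrightarrow> deep k (S v) \<longleftrightarrow> (\<exists>w\<in>desc v. dep w = dep v + k)"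
proof (induction k arbitrary: v)
  case 0
  show ?case by (auto intro!: bexI[of _ v])
next
  case (Suc k)
  have "deep (Suc k) (S v) \<longleftrightarrow> (\<exists>c\<in>ch v. deep k (S c))" using Suc.prems by (simp add: subtrees_S)
  also have "\<dots> \<longleftrightarrow> (\<exists>c\<in>ch v. \<exists>w\<in>desc c. dep w = dep c + k)" using Suc.IH ch_subset by blast
  also have "\<dots> \<longleftrightarrow> (\<exists>w\<in>desc v. dep w = dep v + Suc k)"
    unfolding bex_desc[of v] using dep_ch by auto
  finally show ?case .
qed

lemma full_S: "v \<in> verts G \<Longrightarrow> full d k (S v) \<longleftrightarrow> (\<forall>w\<in>desc v. dep w < dep v + k \<longrightarrow> card (ch w) = d)"
proof (induction k arbitrary: v)
  case 0
  show ?case using dep_desc by fastforce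
next
  case (Suc k)
  have "full d (Suc k) (S v) \<longleftrightarrow> card (ch v) = d \<and> (\<forall>c\<in>ch v. full d k (S c))"
    using Suc.prems by (simp add: subtrees_S size_S)
  also have "\<dots> \<longleftrightarrow> card (ch v) = d \<and> (\<forall>c\<in>ch v. \<forall>w\<in>desc c. dep w < dep c + k \<longrightarrow> card (ch w) = d)"
    using Suc.IH ch_subset by blast
  also have "\<dots> \<longleftrightarrow> (\<forall>w\<in>desc v. dep w < dep v + Suc k \<longrightarrow> card (ch w) = d)"
    unfolding ball_desc[of v] using dep_ch by auto
  finally show ?case .
qed

lemma bounded_S: "v \<in> verts G \<Longrightarrow> bounded_tree d (S v) \<longleftrightarrow> (\<forall>w\<in>desc v. card (ch w) \<le> d)"
proof (induction rule: tree_induct)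
  case (step v)
  have "bounded_tree d (S v) \<longleftrightarrow> card (ch v) \<le> d \<and> (\<forall>c\<in>ch v. bounded_tree d (S c))"
    using step(1) by (subst S_eq) auto
  then show ?case unfolding ball_desc[of v] using step(2) by simp
qed

lemma thin_S: "v \<in> verts G \<Longrightarrow> thin d (S v) \<longleftrightarrow> (\<forall>w\<in>desc v. card {u \<in> ch w. incomplete d (S u)} \<le> 1)"
proof (induction rule: tree_induct)
  case (step v)
  have "thin d (S v) \<longleftrightarrow> card {u \<in> ch v. incomplete d (S u)} \<le> 1 \<and> (\<forall>c\<in>ch v. thin d (S c))"
    using step(1) size_filter_S[OF step(1), of "incomplete d"] subtrees_S[OF step(1)]
      by (cases "S v") auto
  then show ?case unfolding ball_desc[of v] using step(2) by simp
qed

lemma admissible_S: "admissible d (S r) \<longleftrightarrow> (\<forall>v\<in>verts G. vdegree G v \<le> d + 1)"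
proof -
  have "(\<forall>v\<in>verts G. vdegree G v \<le> d + 1) \<longleftrightarrow> (\<forall>v\<in>desc r. vdegree G v \<le> d + 1)"
    by (simp add: desc_root)
  also have "\<dots> \<longleftrightarrow> vdegree G r \<le> d + 1 \<and> (\<forall>c\<in>ch r. \<forall>w\<in>desc c. vdegree G w \<le> d + 1)"
    by (rule ball_desc)
  also have "\<dots> \<longleftrightarrow> card (ch r) \<le> d + 1 \<and> (\<forall>c\<in>ch r. \<forall>w\<in>desc c. card (ch w) \<le> d)"
  proof -
    have "vdegree G w = Suc (card (ch w))" if "c \<in> ch r" "w \<in> desc c" for c w
    proof -
      have "dep w \<noteq> 0" using dep_desc[OF that(2)] dep_ch[OF that(1)] by simp
      then have "w \<noteq> r" using dep_root by auto
      moreover have "w \<in> verts G" using that desc_subset ch_subset by blast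
      ultimately show ?thesis by (simp add: vdegree_eq)
    qed
    then show ?thesis by (simp add: vdegree_eq root_in)
  qed
  also have "\<dots> \<longleftrightarrow> admissible d (S r)"
    using bounded_S[OF ch_in] by (simp add: admissible_def size_S subtrees_S root_in)
  finally show ?thesis ..
qed

lemma ex_leaf: "v \<in> verts G \<Longrightarrow> \<exists>w\<in>desc v. ch w = {}"
proof (induction rule: tree_induct)
  case (step v)
  then show ?case by (subst bex_desc) blast
qed

lemma full_complete: "full d h (complete_mtree d h)"
  by (induction h) auto

lemma not_deep_complete: "\<not> deep (Suc h) (complete_mtree d h)"
  by (induction h) auto

lemma complete_root_iff:
  assumes d: "0 < d"
  shows "complete_dary_tree d G r \<longleftrightarrow> \<not> incomplete d (S r)"
proof
  assume "complete_dary_tree d G r"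
  then obtain h where card: "\<And>v. v \<in> verts G \<Longrightarrow> card (ch v) = 0 \<or> card (ch v) = d"
    and leaf: "\<And>v. v \<in> verts G \<Longrightarrow> ch v = {} \<Longrightarrow> dep v = h - 1"
    by (auto simp: complete_dary_tree_def rooted_dary_tree_def children_eq gdist_eq)
  have dep_le: "dep w \<le> h - 1" if w: "w \<in> verts G" for w
  proof -
    obtain l where "l \<in> desc w" "ch l = {}" using ex_leaf[OF w] by blast
    then show ?thesis using leaf[of l] dep_desc[of l w] desc_subset[OF w] by auto
  qed
  have "full d (h - 1) (S r)"
    using card leaf by (fastforce simp: full_S root_in desc_root dep_root)
  moreover have "\<not> deep (Suc (h - 1)) (S r)"
    using dep_le by (fastforce simp: deep_S root_in desc_root dep_root simp del: deep.simps)
  ultimately have "S r = complete_mtree d (h - 1)" by (rule full_eq_complete)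
  then show "\<not> incomplete d (S r)" by (auto simp: incomplete_def)
next
  assume "\<not> incomplete d (S r)"
  then obtain h where h: "S r = complete_mtree d h" by (auto simp: incomplete_def)
  have f: "card (ch w) = d" if "w \<in> verts G" "dep w < h" for w
    using full_complete[of d h] that unfolding h[symmetric] full_S[OF root_in] desc_root dep_root
      by simp
  have nd: "dep w \<noteq> Suc h" if "w \<in> verts G" for w
    using not_deep_complete[of h d] that
      unfolding h[symmetric] deep_S[OF root_in] desc_root dep_root by auto
  have le: "dep w \<le> h" if "w \<in> verts G" for w
    using that
  proof (induction "dep w" arbitrary: w)
    case (Suc k)
    then have "w \<noteq> r" using dep_root by auto
    then have "dep (par w) \<le> h" "dep w = Suc (dep (par w))" using Suc dep_par par_in by auto
    then show ?case using nd[OF Suc.prems] by simp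
  qed simp
  have e: "ch w = {}" if "w \<in> verts G" "dep w = h" for w
    using nd dep_ch ch_subset that(2) by fastforce
  have leaf: "dep w = h" if "w \<in> verts G" "ch w = {}" for w
    using f[OF that(1)] le[OF that(1)] that(2) d by (cases "dep w < h") auto
  show "complete_dary_tree d G r"
    unfolding complete_dary_tree_def rooted_dary_tree_def
  proof (intro conjI ballI exI[of _ "Suc h"] impI)
    fix v assume v: "v \<in> verts G"
    show "card (children G r v) = 0 \<or> card (children G r v) = d"
      using f[OF v] e[OF v] le[OF v] by (cases "dep v < h") (auto simp: children_eq v)
    assume "children G r v = {}"
    then show "gdist G r v = Suc h - 1" using leaf[OF v] by (simp add: children_eq gdist_eq v)
  qed (use tree_G root_in in auto)
qed

lemma rooted_subtree:
  assumes u: "u \<in> verts G"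
  shows "rooted (subtree_at G r u) u par (\<lambda>v. dep v - dep u) S"
proof -
  interpret T: parented "subtree_at G r u" u par "\<lambda>v. dep v - dep u"
    using parented_subtree(1)[OF u] .
  have V: "verts (subtree_at G r u) = desc u"
    by (simp add: subtree_at_def induced_def descendants_eq u)
  show ?thesis
  proof
    fix v assume "v \<in> verts (subtree_at G r u)"
    then have "v \<in> desc u" "v \<in> verts G" using desc_subset[OF u] by (auto simp: V)
    then show "S v = Node (image_mset S (mset_set (T.ch v)))"
      using S_eq parented_subtree(2)[OF u] by simp
  qed
qed

lemma complete_subtree_iff: "u \<in> verts G \<Longrightarrow> 0 < d \<Longrightarrow>
    complete_dary_tree d (subtree_at G r u) u \<longleftrightarrow> \<not> incomplete d (S u)"
  using rooted.complete_root_iff[OF rooted_subtree] .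

text \<open>The number \<open>j\<close> corresponds to height minus 2: the last greedy condition
  fills all vertices at least two levels above the deepest one. Conversely, vertices of depth at
  most \<open>j\<close> have degree \<open>d + 1\<close>, so pendent vertices occur only at depths
  \<open>j + 1\<close> and \<open>j + 2\<close>.\<close>

lemma greedy_iff:
  assumes d: "0 < d"
  shows "greedy_rooted_tree d G r \<longleftrightarrow> greedy_shape d (S r)"
proof -
  have fin: "finite (vdegree G ` verts G)" using finite_verts by simp
  have incomp: "card {u \<in> children G r v. \<not> complete_dary_tree d (subtree_at G r u) u} =
      card {u \<in> ch v. incomplete d (S u)}" if "v \<in> verts G" for v
    using complete_subtree_iff d ch_subset that
      by (intro arg_cong[of _ _ card]) (auto simp: children_eq)
  have thin: "thin d (S r) \<longleftrightarrow> (\<forall>v\<in>verts G. card {u \<in> children G r v. \<not> complete_dary_tree d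
    (subtree_at G r u) u} \<le> 1)"
    using incomp by (simp add: thin_S root_in desc_root)
  have dep1: "(\<exists>c\<in>ch r. w \<in> desc c) \<longleftrightarrow> w \<in> verts G \<and> w \<noteq> r" for w
  proof -
    have "w \<in> verts G \<longleftrightarrow> w = r \<or> (\<exists>c\<in>ch r. w \<in> desc c)" using desc_eq[of r] desc_root by auto
    then show ?thesis using self_notin_desc_ch by blast
  qed
  have dep_pos: "dep w > 0" if "w \<in> verts G" "w \<noteq> r" for w using dep_par that by simp
  have ball: "(\<forall>c\<in>ch r. \<forall>w\<in>desc c. P w) \<longleftrightarrow> (\<forall>w\<in>verts G. w \<noteq> r \<longrightarrow> P w)" for P using dep1 by blast
  have c1: "dep c = 1" "c \<in> verts G" if "c \<in> ch r" for c
    using dep_ch[OF that] dep_root ch_subset that by auto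
  \<comment> \<open>Branches of the root start at depth 1, which shifts both bounds by one.\<close>
  have shape: "greedy_shape d (S r) \<longleftrightarrow> card (ch r) = d + 1 \<and> thin d (S r) \<and>
    (\<exists>j. \<forall>w\<in>verts G. w \<noteq> r \<longrightarrow> card (ch w) \<le> d \<and> (dep w < Suc j \<longrightarrow> card (ch w) = d) \<and> dep w \<noteq> Suc (j +
      2))"
    unfolding greedy_shape_def ball[symmetric] size_S[OF root_in] subtrees_S[OF root_in] ball_simps
    using c1 by (simp add: bounded_S full_S deep_S ball_conj_distrib del: deep.simps full.simps
      add_2_eq_Suc' add_2_eq_Suc cong: ball_cong)
  show ?thesis
  proof
    assume g: "greedy_rooted_tree d G r"
    then have md: "max_degree G = d + 1" and vr: "vdegree G r = d + 1"
      and lev: "\<And>v w. v \<in> verts G \<Longrightarrow> w \<in> verts G \<Longrightarrow> dep v + 2 \<le> dep w \<Longrightarrow> vdegree G v = d + 1"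
      by (auto simp: greedy_rooted_tree_def gdist_eq)
    have bd: "vdegree G v \<le> d + 1" if "v \<in> verts G" for v
      using Max_ge[OF fin, of "vdegree G v"] md that by (simp add: max_degree_def)
    define H where "H = Max (dep ` verts G)"
    have H: "dep w \<le> H" if "w \<in> verts G" for w using that finite_verts by (simp add: H_def)
    have "H \<in> dep ` verts G" unfolding H_def using finite_verts root_in by (intro Max_in) auto
    then obtain w0 where w0: "w0 \<in> verts G" "dep w0 = H" by blast
    \<comment> \<open>For a star \<open>H - 2\<close> truncates to 0, which is harmless because
      every vertex other than the root has positive depth.\<close>
    have "card (ch w) \<le> d \<and> (dep w < Suc (H - 2) \<longrightarrow> card (ch w) = d) \<and> dep w \<noteq> Suc (H - 2 + 2)"
      if w: "w \<in> verts G" "w \<noteq> r" for w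
    proof (intro conjI impI)
      show "card (ch w) \<le> d" using bd[OF w(1)] w by (simp add: vdegree_eq)
      show "dep w \<noteq> Suc (H - 2 + 2)" using H[OF w(1)] by linarith
      assume "dep w < Suc (H - 2)"
      then have "dep w + 2 \<le> dep w0" using dep_pos[OF w] w0(2) by linarith
      then show "card (ch w) = d" using lev[OF w(1) w0(1)] w by (simp add: vdegree_eq)
    qed
    then show "greedy_shape d (S r)"
      unfolding shape using g vr thin by (auto simp: greedy_rooted_tree_def vdegree_eq root_in)
  next
    assume "greedy_shape d (S r)"
    then obtain j where cr: "card (ch r) = d + 1" and th: "thin d (S r)"
      and j: "\<And>w. w \<in> verts G \<Longrightarrow> w \<noteq> r \<Longrightarrow> card (ch w) \<le> d \<and> (dep w < Suc j \<longrightarrow> card (ch w) = d)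
        \<and> dep w \<noteq> Suc (j + 2)"
      unfolding shape by blast
    have vr: "vdegree G r = d + 1" using cr by (simp add: vdegree_eq root_in)
    have bd: "vdegree G v \<le> d + 1" if "v \<in> verts G" for v
      using vr j that by (cases "v = r") (auto simp: vdegree_eq)
    \<comment> \<open>Excluding the single depth \<open>j + 3\<close> bounds all depths, since every
      vertex other than the root has a parent exactly one level higher.\<close>
    have le: "dep w \<le> j + 2" if "w \<in> verts G" for w
      using that
    proof (induction "dep w" arbitrary: w)
      case (Suc k)
      then have "w \<noteq> r" using dep_root by auto
      then have "dep (par w) \<le> j + 2" "dep w = Suc (dep (par w))" using Suc dep_par par_in by auto
      then show ?case using j[OF Suc.prems \<open>w \<noteq> r\<close>] by simp
    qed simp
    have full: "vdegree G v = d + 1" if "v \<in> verts G" "dep v \<le> j" for v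
      using vr j that by (cases "v = r") (auto simp: vdegree_eq)
    show "greedy_rooted_tree d G r"
      unfolding greedy_rooted_tree_def
    proof (intro conjI ballI impI)
      show "max_degree G = d + 1" unfolding max_degree_def
        using fin bd vr root_in by (intro Max_eqI) (auto intro: rev_image_eqI)
      fix v assume v: "v \<in> verts G"
      show "card {u \<in> children G r v. \<not> complete_dary_tree d (subtree_at G r u) u} \<le> 1"
        using th thin v by blast
      fix w assume w: "w \<in> verts G"
      {
        assume "vdegree G v = 1 \<and> vdegree G w = 1"
        then have "\<not> dep w \<le> j" using full[OF w] d by auto
        then show "gdist G r v \<le> gdist G r w + 1" using le[OF v] by (simp add: gdist_eq v w)
      next
        assume "gdist G r v + 2 \<le> gdist G r w"
        then have "dep v \<le> j" using le[OF w] by (simp add: gdist_eq v w)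
        then show "vdegree G v = d + 1" by (rule full[OF v])
      }
    qed (use tree_G root_in vr in auto)
  qed
qed

end

text \<open>Parents are taken in a breadth-first search; an edge that does not join a vertex to its parent
  would close a cycle with the path through the search tree.\<close>

lemma ex_parented:
  assumes G: "tree G" and r: "r \<in> verts G"
  shows "\<exists>par dep. parented G r par dep"
proof -
  have simple: "simple_graph G" and conn: "connected_graph G" and acyc: "\<And>p. \<not> graph_cycle G p"
    using G by (auto simp: tree_def)
  define dep where "dep v = (LEAST k. (r, v) \<in> adj G ^^ k)" for v
  have reach: "(r, v) \<in> adj G ^^ dep v" if "v \<in> verts G" for v
  proof -
    obtain p where "path_between G r v p" using conn r \<open>v \<in> verts G\<close> unfolding connected_graph_def
      by blast
    then have "(r, v) \<in> (adj G)\<^sup>*" by (rule path_rtrancl_adj)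
    then obtain k where "(r, v) \<in> adj G ^^ k" using rtrancl_imp_relpow by fast
    then show ?thesis unfolding dep_def by (rule LeastI)
  qed
  have dep_le: "dep v \<le> k" if "(r, v) \<in> adj G ^^ k" for v k
    unfolding dep_def using that by (rule Least_le)
  have ex_par: "\<exists>u. (u, v) \<in> adj G \<and> dep v = Suc (dep u)" if v: "v \<in> verts G" "v \<noteq> r" for v
  proof -
    have "dep v \<noteq> 0" using reach[OF v(1)] v(2) by (metis relpow_0_E)
    then obtain k where k: "dep v = Suc k" by (cases "dep v") auto
    then obtain u where u: "(r, u) \<in> adj G ^^ k" "(u, v) \<in> adj G" using reach[OF v(1)]
      by (auto elim: relpow_Suc_E)
    then have "u \<in> verts G" by (simp add: adj_def)
    then have "(r, v) \<in> adj G ^^ Suc (dep u)" using reach u(2) by (auto intro: relpow_Suc_I)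
    then have "dep v \<le> Suc (dep u)" by (rule dep_le)
    then have "dep v = Suc (dep u)" using dep_le[OF u(1)] k by simp
    then show ?thesis using u(2) by blast
  qed
  define par where "par v = (SOME u. (u, v) \<in> adj G \<and> dep v = Suc (dep u))" for v
  have par: "(par v, v) \<in> adj G \<and> dep v = Suc (dep (par v))" if "v \<in> verts G" "v \<noteq> r" for v
    unfolding par_def using ex_par[OF that] by (rule someI_ex)
  define E' where "E' = (\<lambda>v. {v, par v}) ` (verts G - {r})"
  interpret P: parented "(verts G, E')" r par dep
  proof
    show "finite (verts (verts G, E'))" using simple by (simp add: simple_graph_def)
    have "(r, r) \<in> adj G ^^ 0" by simp
    from dep_le[OF this] show "dep r = 0" by simp
  qed (use r par in \<open>auto simp: E'_def adj_def\<close>)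
  have sub: "E' \<subseteq> edges G" using par by (auto simp: E'_def adj_def insert_commute)
  have "edges G \<subseteq> E'"
  proof
    fix e assume e: "e \<in> edges G"
    then have "e \<subseteq> verts G" "card e = 2" using simple by (auto simp: simple_graph_def)
    then obtain u v where uv: "e = {u, v}" "u \<noteq> v" "u \<in> verts G" "v \<in> verts G"
      by (auto simp: card_2_iff)
    show "e \<in> E'"
    proof (rule ccontr)
      assume ne: "e \<notin> E'"
      obtain p where p: "path_between (verts G, E') u v p"
        using P.connected_G uv(3,4) unfolding connected_graph_def fst_conv by blast
      then have pp: "p \<noteq> []" "distinct p" "set p \<subseteq> verts G" "successively (\<lambda>u v. {u, v} \<in> E') p"
        "hd p = u" "last p = v"
        by (auto simp: path_between_def graph_path_def)
      have "length p \<ge> 3"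
      proof (rule ccontr)
        assume "\<not> length p \<ge> 3"
        moreover have "length p \<noteq> 0" using pp(1) by simp
        ultimately consider "length p = 1" | "length p = 2" by linarith
        then show False
        proof cases
          case 1
          then show False using pp uv by (auto simp: length_Suc_conv)
        next
          case 2
          then obtain a b where "p = [a, b]" by (auto simp: length_Suc_conv numeral_2_eq_2)
          then show False using pp ne uv by auto
        qed
      qed
      moreover have "successively (\<lambda>u v. {u, v} \<in> edges G) p"
        using pp(4) by (rule successively_mono) (use sub in auto)
      ultimately have "graph_cycle G p"
        using pp e uv by (auto simp: graph_cycle_def graph_path_def insert_commute)
      then show False using acyc by blast
    qed
  qed
  then have "(verts G, E') = G" using sub by (metis prod.collapse subset_antisym)
  then show ?thesis using P.parented_axioms by auto
qed

text \<open>The shape of a branch recurses through the graph, so it is computed with fuel. At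
  \<open>v\<close> the fuel \<open>H - dep v\<close> is enough when \<open>H\<close> is the greatest
  depth.\<close>

primrec unfold_tree :: "('a \<Rightarrow> 'a set) \<Rightarrow> nat \<Rightarrow> 'a \<Rightarrow> mtree" where
  "unfold_tree c 0 v = Node {#}"
| "unfold_tree c (Suc k) v = Node (image_mset (unfold_tree c k) (mset_set (c v)))"

lemma (in parented) ex_rooted: "\<exists>S. rooted G r par dep S"
proof -
  define H where "H = Max (dep ` verts G)"
  have H: "dep w \<le> H" if "w \<in> verts G" for w using that finite_verts by (simp add: H_def)
  define S where "S v = unfold_tree ch (H - dep v) v" for v
  have "S v = Node (image_mset S (mset_set (ch v)))" if v: "v \<in> verts G" for v
  proof (cases "H - dep v")
    case 0
    have "ch v = {}"
    proof (rule ccontr)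
      assume "ch v \<noteq> {}"
      then obtain c where "c \<in> ch v" by blast
      then show False using dep_ch[of c v] H[of c] ch_subset[of v] 0 by auto
    qed
    then show ?thesis using 0 by (simp add: S_def)
  next
    case (Suc k)
    have "H - dep c = k" if "c \<in> ch v" for c using dep_ch[OF that] Suc by simp
    then have "image_mset (unfold_tree ch k) (mset_set (ch v)) = image_mset S (mset_set (ch v))"
      by (intro image_mset_cong) (simp add: S_def)
    then show ?thesis by (simp add: S_def Suc)
  qed
  then have "rooted G r par dep S" by unfold_locales
  then show ?thesis by blast
qed

section \<open>Shapes of rooted graphs and isomorphism\<close>

definition rooting :: "'a ugraph \<Rightarrow> 'a \<Rightarrow> mtree \<Rightarrow> bool" where
  "rooting G r t \<longleftrightarrow> (\<exists>par dep S. rooted G r par dep S \<and> S r = t)"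

lemma ex_rooting:
  assumes "tree G" "r \<in> verts G"
  shows "\<exists>t. rooting G r t"
proof -
  obtain par dep where "parented G r par dep" using ex_parented[OF assms] by blast
  then show ?thesis using parented.ex_rooted by (fastforce simp: rooting_def)
qed

text \<open>Split off one branch \<open>s\<close>: \<open>V1\<close> carries the root with the
  remaining branches, \<open>V2\<close> carries \<open>s\<close>, and the new edge joins the two
  roots. The vertex set is prescribed because labelled trees must live on
  \<open>{0..<n}\<close>.\<close>

lemma realise:
  fixes V :: "'a set"
  assumes "finite V" "card V = nodes t" "r \<in> V"
  shows "\<exists>E par dep S. rooted (V, E) r par dep S \<and> S r = t"
  using assms
proof (induction "nodes t" arbitrary: t V r rule: less_induct)
  case less
  obtain M where t: "t = Node M" by (cases t)
  show ?case
  proof (cases M)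
    case empty
    then have "V = {r}" using less.prems by (auto simp: t card_1_singleton_iff)
    moreover have "rooted ({r}, {}) r id (\<lambda>_. 0) (\<lambda>_. Node {#})"
    proof -
      interpret parented "({r}, {})" r id "\<lambda>_. 0" by unfold_locales auto
      show ?thesis by unfold_locales (auto simp: ch_def)
    qed
    ultimately show ?thesis using t empty
      by (intro exI[of _ "{}"] exI[of _ id] exI[of _ "\<lambda>_. 0"] exI[of _ "\<lambda>_. Node {#}"]) simp
  next
    case (add s M')
    have cV: "card V = nodes (Node M') + nodes s" using less.prems by (simp add: t add)
    have "nodes (Node M') - 1 \<le> card (V - {r})" using less.prems cV nodes_pos[of s] by simp
    then obtain W where W: "W \<subseteq> V - {r}" "card W = nodes (Node M') - 1"
      using less.prems(1) by (metis obtain_subset_with_card_n)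
    define V1 V2 where "V1 = insert r W" and "V2 = V - V1"
    have fW: "finite W" using W(1) less.prems(1) by (meson finite_Diff finite_subset)
    have V1: "finite V1" "card V1 = nodes (Node M')" "r \<in> V1" "V1 \<subseteq> V"
      using W fW less.prems by (auto simp: V1_def card_insert_if)
    have V2: "finite V2" "card V2 = nodes s" using V1 less.prems(1) cV
      by (auto simp: V2_def card_Diff_subset)
    obtain r2 where r2: "r2 \<in> V2" using V2(2) nodes_pos[of s] by fastforce
    have lt: "nodes (Node M') < nodes t" "nodes s < nodes t" using nodes_pos[of s]
      by (auto simp: t add)
    obtain E1 p1 d1 S1 where 1: "rooted (V1, E1) r p1 d1 S1" "S1 r = Node M'"
      using less.hyps[OF lt(1) V1(1,2,3)] by blast
    obtain E2 p2 d2 S2 where 2: "rooted (V2, E2) r2 p2 d2 S2" "S2 r2 = s"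
      using less.hyps[OF lt(2) V2 r2] by blast
    interpret A: rooted "(V1, E1)" r p1 d1 S1 by fact
    interpret B: rooted "(V2, E2)" r2 p2 d2 S2 by fact
    have disj: "V1 \<inter> V2 = {}" "V = V1 \<union> V2" using V1(4) by (auto simp: V2_def)
    have rV2: "r \<notin> V2" "r2 \<notin> V1" using disj V1(3) r2 by auto
    define par where "par v = (if v \<in> V1 then p1 v else if v = r2 then r else p2 v)" for v
    define dep where "dep v = (if v \<in> V1 then d1 v else Suc (d2 v))" for v
    define E where "E = (\<lambda>v. {v, par v}) ` (V - {r})"
    interpret P: parented "(V, E)" r par dep
    proof
      show "finite (verts (V, E))" using less.prems(1) by simp
      show "r \<in> verts (V, E)" using less.prems(3) by simp
      show "dep r = 0" using A.dep_root V1(3) by (simp add: dep_def)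
      show "edges (V, E) = (\<lambda>v. {v, par v}) ` (verts (V, E) - {r})" by (simp add: E_def)
      fix v assume v: "v \<in> verts (V, E)" "v \<noteq> r"
      consider "v \<in> V1" | "v \<in> V2" "v = r2" | "v \<in> V2" "v \<noteq> r2" using v disj by auto
      then have "par v \<in> V \<and> dep v = Suc (dep (par v))"
      proof cases
        case 1
        then show ?thesis using A.par_in[of v] A.dep_par[of v] v disj by (simp add: par_def dep_def)
      next
        case 2
        then show ?thesis using A.dep_root B.dep_root V1 rV2 disj by (simp add: par_def dep_def)
      next
        case 3
        then have "v \<notin> V1" "p2 v \<in> V2" "p2 v \<notin> V1" using B.par_in[of v] disj by auto
        then show ?thesis using B.dep_par[of v] 3 disj by (simp add: par_def dep_def)
      qed
      then show "par v \<in> verts (V, E)" "dep v = Suc (dep (par v))" by auto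
    qed
    define S where "S v = (if v \<in> V2 then S2 v else if v = r then t else S1 v)" for v
    have par1: "par v = p1 v \<and> p1 v \<in> V1 \<and> p1 v \<notin> V2" if "v \<in> V1" "v \<noteq> r" for v
      using A.par_in[of v] that disj by (auto simp: par_def)
    have par2: "par v = p2 v \<and> p2 v \<in> V2 \<and> p2 v \<notin> V1" if "v \<in> V2" "v \<noteq> r2" for v
      using B.par_in[of v] that disj by (auto simp: par_def)
    have par_r2: "par r2 = r" using rV2 by (simp add: par_def)
    have chP_iff: "u \<in> P.ch v \<longleftrightarrow> u \<in> V \<and> u \<noteq> r \<and> par u = v" for u v
      by (simp add: P.ch_def)
    have chs1: "u \<in> P.ch v \<longleftrightarrow> u \<in> A.ch v" if "u \<in> V1" for u v
      using par1[of u] that disj(2) unfolding chP_iff A.ch_def by auto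
    have chs2: "r2 \<in> P.ch v \<longleftrightarrow> v = r" for v
      using par_r2 rV2(1) r2 disj(2) unfolding chP_iff by auto
    have chs3: "u \<in> P.ch v \<longleftrightarrow> u \<in> B.ch v" if "u \<in> V2" "u \<noteq> r2" for u v
      using par2[of u] that rV2(1) disj(2) unfolding chP_iff B.ch_def by auto
    have chV: "u \<in> V1 \<or> u \<in> V2" if "u \<in> P.ch v" for u v using that[unfolded chP_iff] disj(2)
      by blast
    have chA: "u \<in> V1" "u \<noteq> r" "v \<in> V1" if "u \<in> A.ch v" for u v
      using that A.par_in[of u] by (auto simp: A.ch_def)
    have chB: "u \<in> V2" "u \<noteq> r2" "v \<in> V2" if "u \<in> B.ch v" for u v
      using that B.par_in[of u] by (auto simp: B.ch_def)
    have ch2: "P.ch v = B.ch v" if v: "v \<in> V2" for v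
    proof (intro equalityI subsetI)
      fix u assume u: "u \<in> P.ch v"
      have "u \<notin> V1" using u v chs1[of u v] chA(3)[of u v] disj(1) by blast
      moreover have "u \<noteq> r2" using u v chs2[of v] rV2(1) by blast
      ultimately show "u \<in> B.ch v" using u chV[OF u] chs3 by blast
    qed (use chB(1,2) chs3 in blast)
    have ch1: "P.ch v = A.ch v" if v: "v \<in> V1" "v \<noteq> r" for v
    proof (intro equalityI subsetI)
      fix u assume u: "u \<in> P.ch v"
      have "u \<noteq> r2" using u v(2) chs2[of v] by blast
      then have "u \<notin> V2" using u v(1) chs3[of u v] chB(3)[of u v] disj(1) by blast
      then show "u \<in> A.ch v" using u chV[OF u] chs1 by blast
    qed (use chA(1) chs1 in blast)
    have chr: "P.ch r = insert r2 (A.ch r)"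
    proof (intro equalityI subsetI)
      fix u assume u: "u \<in> P.ch r"
      then have "u \<in> V2 \<Longrightarrow> u = r2" using chs3[of u r] chB(3)[of u r] rV2(1) by blast
      then show "u \<in> insert r2 (A.ch r)" using u chV[OF u] chs1 by blast
    qed (use chA(1) chs1 chs2 in blast)
    have S1: "image_mset S (mset_set (A.ch v)) = image_mset S1 (mset_set (A.ch v))" for v
    proof (rule image_mset_cong)
      fix u assume "u \<in># mset_set (A.ch v)"
      then have "u \<in> A.ch v" by simp
      then have "u \<notin> V2" "u \<noteq> r" using chA[of u v] disj(1) by blast+
      then show "S u = S1 u" by (simp add: S_def)
    qed
    have "S v = Node (image_mset S (mset_set (P.ch v)))" if v: "v \<in> V" for v
    proof -
      consider "v \<in> V2" | "v \<in> V1" "v \<noteq> r" | "v = r" using v disj by auto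
      then show ?thesis
      proof cases
        case 1
        have "image_mset S (mset_set (B.ch v)) = image_mset S2 (mset_set (B.ch v))"
        proof (rule image_mset_cong)
          fix u assume "u \<in># mset_set (B.ch v)"
          then have "u \<in> B.ch v" by simp
          then show "S u = S2 u" using chB(1) by (simp add: S_def)
        qed
        then show ?thesis using B.S_eq[of v] 1 by (simp add: ch2 S_def)
      next
        case 2
        then have "v \<notin> V2" using disj by auto
        then show ?thesis using A.S_eq[of v] 2 by (simp add: ch1 S1) (simp add: S_def)
      next
        case 3
        have "r2 \<notin> A.ch r" using A.ch_subset[of r] rV2 by auto
        then have "image_mset S (mset_set (P.ch r))
          = add_mset (S r2) (image_mset S1 (mset_set (A.ch r)))"
          by (simp add: chr S1)
        also have "\<dots> = add_mset s M'" using A.S_eq[of r] V1(3) 1 2 r2 by (simp add: S_def)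
        finally show ?thesis using 3 rV2 by (simp add: S_def t add)
      qed
    qed
    then have "rooted (V, E) r par dep S" by unfold_locales simp
    moreover have "S r = t" using rV2 by (simp add: S_def)
    ultimately show ?thesis by blast
  qed
qed

lemma ex_bij_image_mset:
  assumes "finite A" "finite B" "image_mset f (mset_set A) = image_mset g (mset_set B)"
  shows "\<exists>h. bij_betw h A B \<and> (\<forall>a\<in>A. g (h a) = f a)"
  using assms
proof (induction A arbitrary: B rule: finite_induct)
  case empty
  then have "B = {}" by (simp add: mset_set_empty_iff)
  then show ?case by (auto simp: bij_betw_def)
next
  case (insert a A)
  have eq: "image_mset g (mset_set B) = add_mset (f a) (image_mset f (mset_set A))"
    using insert.prems insert.hyps by simp
  then have "f a \<in># image_mset g (mset_set B)" by simp
  then obtain b where b: "b \<in> B" "g b = f a" using insert.prems(1) by auto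
  define B' where "B' = B - {b}"
  have B: "B = insert b B'" "b \<notin> B'" "finite B'" using b(1) insert.prems(1) by (auto simp: B'_def)
  have "image_mset f (mset_set A) = image_mset g (mset_set B')"
    using eq b(2) B by simp
  from insert.IH[OF B(3) this] obtain h where h: "bij_betw h A B'" "\<forall>x\<in>A. g (h x) = f x" by blast
  have h_eq: "bij_betw (h(a := b)) A B'"
    by (subst bij_betw_cong[of A _ h]) (use insert.hyps h in auto)
  have "bij_betw (h(a := b)) (insert a A) (insert b B')"
    using h_eq B insert.hyps notIn_Un_bij_betw[of a A "h(a := b)" B'] by simp
  moreover have "\<forall>x\<in>insert a A. g ((h(a := b)) x) = f x" using h(2) b(2) insert.hyps by auto
  ultimately show ?case unfolding B(1) by blast
qed

text \<open>Vertices of equal shape admit a shape-preserving matching \<open>g\<close> of their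
  children. Following these matchings down from the roots gives a map that is injective; equal node
  counts make it bijective.\<close>

lemma rooting_iso:
  assumes "rooting G r t" "rooting G' r' t"
  shows "graph_iso G G'"
proof -
  obtain par dep S par' dep' S' where "rooted G r par dep S" "rooted G' r' par' dep' S'"
    and t: "S r = t" "S' r' = t" using assms unfolding rooting_def by blast
  interpret A: rooted G r par dep S by fact
  interpret B: rooted G' r' par' dep' S' by fact
  define g where "g v v' = (SOME h. bij_betw h (A.ch v) (B.ch v') \<and> (\<forall>a\<in>A.ch v. S' (h a) = S a))"
    for v v'
  have g: "bij_betw (g v v') (A.ch v) (B.ch v') \<and> (\<forall>a\<in>A.ch v. S' (g v v' a) = S a)"
    if "v \<in> verts G" "v' \<in> verts G'" "S v = S' v'" for v v'
  proof -
    have "image_mset S (mset_set (A.ch v)) = image_mset S' (mset_set (B.ch v'))"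
      using A.S_eq[OF that(1)] B.S_eq[OF that(2)] that(3) by simp
    from someI_ex[OF ex_bij_image_mset[OF A.finite_ch B.finite_ch this]]
    show ?thesis unfolding g_def .
  qed
  \<comment> \<open>Recursion on depth: the image of \<open>u\<close> is its partner among the
    children of the image of its parent.\<close>
  define F where "F = rec_nat (\<lambda>_. r') (\<lambda>_ f u. g (par u) (f (par u)) u)"
  define f where "f u = F (dep u) u" for u
  have f_root: "f r = r'" by (simp add: f_def F_def A.dep_root)
  have f_step: "f u = g (par u) (f (par u)) u" if "u \<in> verts G" "u \<noteq> r" for u
    using A.dep_par[OF that] by (simp add: f_def F_def)
  have f: "f u \<in> verts G' \<and> S' (f u) = S u \<and> dep' (f u) = dep u" if "u \<in> verts G" for u
    using that
  proof (induction "dep u" arbitrary: u rule: less_induct)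
    case less
    show ?case
    proof (cases "u = r")
      case True
      then show ?thesis using f_root B.root_in t A.dep_root B.dep_root by simp
    next
      case False
      have p: "par u \<in> verts G" "dep u = Suc (dep (par u))" "u \<in> A.ch (par u)"
        using A.par_in A.dep_par False less.prems by (auto simp: A.ch_def)
      have IH: "f (par u) \<in> verts G'" "S' (f (par u)) = S (par u)" "dep' (f (par u)) = dep (par u)"
        using less.hyps[of "par u"] p by auto
      note gg = g[OF p(1) IH(1) IH(2)[symmetric]]
      then have "f u \<in> B.ch (f (par u))" using f_step[OF less.prems False] p(3)
        by (auto dest: bij_betwE)
      then show ?thesis using B.dep_ch[of "f u"] B.ch_subset gg p IH f_step[OF less.prems False]
        by auto
    qed
  qed
  have f_ch: "f u \<in> B.ch (f (par u))" if "u \<in> verts G" "u \<noteq> r" for u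
  proof -
    have p: "par u \<in> verts G" "u \<in> A.ch (par u)" using A.par_in that by (auto simp: A.ch_def)
    then show ?thesis using g[OF p(1), of "f (par u)"] f[OF p(1)] f_step[OF that]
      by (auto dest: bij_betwE)
  qed
  have f_eq_root: "f u = r' \<longleftrightarrow> u = r" if "u \<in> verts G" for u
    using f_ch[OF that] f_root by (auto simp: B.ch_def)
  have inj: "u = w" if "u \<in> verts G" "w \<in> verts G" "f u = f w" for u w
    using that
  proof (induction "dep u" arbitrary: u w rule: less_induct)
    case less
    show ?case
    proof (cases "u = r \<or> w = r")
      case True
      then show ?thesis using f_eq_root less.prems f_root by metis
    next
      case False
      then have nr: "u \<noteq> r" "w \<noteq> r" by auto
      have "f (par u) = f (par w)" using f_ch[of u] f_ch[of w] less.prems nr by (simp add: B.ch_def)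
      moreover have "dep (par u) < dep u" using A.dep_par less.prems nr by simp
      ultimately have pe: "par u = par w" using less.hyps[of "par u" "par w"] A.par_in less.prems nr
        by simp
      have p: "par u \<in> verts G" using A.par_in less.prems nr by simp
      have "inj_on (g (par u) (f (par u))) (A.ch (par u))"
        using g[OF p, of "f (par u)"] f[OF p] by (auto simp: bij_betw_def)
      moreover have "u \<in> A.ch (par u)" "w \<in> A.ch (par u)" using less.prems nr pe
        by (auto simp: A.ch_def)
      moreover have "g (par u) (f (par u)) u = g (par u) (f (par u)) w"
        using less.prems f_step nr pe by metis
      ultimately show ?thesis by (auto dest: inj_onD)
    qed
  qed
  have "card (verts G) = card (verts G')"
    using A.nodes_S[OF A.root_in] B.nodes_S[OF B.root_in] t by (simp add: A.desc_root B.desc_root)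
  then have bij: "bij_betw f (verts G) (verts G')"
    using inj f A.finite_verts B.finite_verts
    by (intro bij_betw_imageI inj_onI card_subset_eq) (auto simp: card_image inj_on_def)
  have ch_iff: "u \<in> A.ch v \<longleftrightarrow> f u \<in> B.ch (f v)" if uv: "u \<in> verts G" "v \<in> verts G" for u v
  proof
    show "f u \<in> B.ch (f v)" if "u \<in> A.ch v" using f_ch[OF uv(1)] that by (auto simp: A.ch_def)
    assume h: "f u \<in> B.ch (f v)"
    then have "u \<noteq> r" using f_root by (auto simp: B.ch_def)
    then have "f (par u) = f v" using f_ch[OF uv(1)] h by (simp add: B.ch_def)
    then have "par u = v" using inj A.par_in uv \<open>u \<noteq> r\<close> by blast
    then show "u \<in> A.ch v" using uv \<open>u \<noteq> r\<close> by (simp add: A.ch_def)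
  qed
  show ?thesis
    unfolding graph_iso_def
    by (rule exI[of _ f]) (use bij ch_iff in \<open>auto simp: A.edge_iff B.edge_iff\<close>)
qed

text \<open>Gives the invariance of the generating function under isomorphism without permuting
  matrices. As \<open>graph_iso\<close> looks only at pairs of vertices,
  \<open>simple_graph G'\<close> has to exclude other members of the edge set.\<close>

lemma rooting_transport:
  assumes iso: "graph_iso G G'" and G': "simple_graph G'" and r: "rooting G r t"
  shows "\<exists>r'\<in>verts G'. rooting G' r' t"
proof -
  obtain f where f: "bij_betw f (verts G) (verts G')"
    and fe: "\<And>u v. u \<in> verts G \<Longrightarrow> v \<in> verts G \<Longrightarrow> {u, v} \<in> edges G \<longleftrightarrow> {f u, f v} \<in> edges G'"
    using iso unfolding graph_iso_def by blast
  obtain par dep S where "rooted G r par dep S" and t: "S r = t" using r unfolding rooting_def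
    by blast
  interpret A: rooted G r par dep S by fact
  define h where "h = the_inv_into (verts G) f"
  have inj: "inj_on f (verts G)" and V': "verts G' = f ` verts G" using f
    by (auto simp: bij_betw_def)
  have hf: "h (f v) = v" if "v \<in> verts G" for v using the_inv_into_f_f[OF inj that]
    by (simp add: h_def)
  define par' dep' S' where "par' v = f (par (h v))" and "dep' v = dep (h v)" and "S' v = S (h v)"
    for v
  have "parented G' (f r) par' dep'"
  proof
    show "finite (verts G')" using A.finite_verts by (simp add: V')
    show "f r \<in> verts G'" using A.root_in by (simp add: V')
    show "dep' (f r) = 0" using A.dep_root A.root_in by (simp add: dep'_def hf)
    show "edges G' = (\<lambda>v. {v, par' v}) ` (verts G' - {f r})"
    proof (intro equalityI subsetI)
      fix e assume e: "e \<in> edges G'"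
      then have "e \<subseteq> verts G'" "card e = 2" using G' by (auto simp: simple_graph_def)
      then obtain a b where ab: "e = {f a, f b}" "a \<in> verts G" "b \<in> verts G"
        by (auto simp: card_2_iff V')
      then have "{a, b} \<in> edges G" using fe e by simp
      then have "a \<noteq> r \<and> par a = b \<or> b \<noteq> r \<and> par b = a" by (auto simp: A.edge_iff A.ch_def)
      then obtain c where c: "c \<in> verts G" "c \<noteq> r" "e = {f c, f (par c)}"
        using ab by (auto simp: insert_commute)
      then have "f c \<noteq> f r" using inj A.root_in by (auto dest: inj_onD)
      then show "e \<in> (\<lambda>v. {v, par' v}) ` (verts G' - {f r})"
        using c by (intro image_eqI[of _ _ "f c"]) (auto simp: V' par'_def hf)
    next
      fix e assume "e \<in> (\<lambda>v. {v, par' v}) ` (verts G' - {f r})"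
      then obtain a where a: "a \<in> verts G" "f a \<noteq> f r" "e = {f a, par' (f a)}" by (auto simp: V')
      then have a: "a \<in> verts G" "a \<noteq> r" "e = {f a, f (par a)}" by (auto simp: par'_def hf)
      then have "{a, par a} \<in> edges G" by (auto simp: A.edges_eq)
      then show "e \<in> edges G'" using fe A.par_in a by simp
    qed
    fix v assume "v \<in> verts G'" "v \<noteq> f r"
    then obtain a where "a \<in> verts G" "a \<noteq> r" "v = f a" by (auto simp: V')
    then show "par' v \<in> verts G'" "dep' v = Suc (dep' (par' v))"
      using A.par_in A.dep_par by (auto simp: V' par'_def dep'_def hf)
  qed
  then interpret B: parented G' "f r" par' dep' .
  have ch: "B.ch (f v) = f ` A.ch v" if v: "v \<in> verts G" for v
  proof -
    have "f a = f b \<longleftrightarrow> a = b" if "a \<in> verts G" "b \<in> verts G" for a b using inj that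
      by (auto dest: inj_onD)
    then show ?thesis using v A.par_in A.root_in
      by (auto simp: B.ch_def A.ch_def V' par'_def hf)
  qed
  have "S' v = Node (image_mset S' (mset_set (B.ch v)))" if v: "v \<in> verts G'" for v
  proof -
    obtain a where a: "a \<in> verts G" "v = f a" using v by (auto simp: V')
    have "inj_on f (A.ch a)" using inj A.ch_subset by (rule inj_on_subset)
    then have "image_mset S' (mset_set (B.ch v)) = image_mset S' (image_mset f (mset_set (A.ch a)))"
      using a by (simp add: ch image_mset_mset_set)
    also have "\<dots> = image_mset S (mset_set (A.ch a))"
      unfolding image_mset.compositionality using A.ch_subset[of a]
      by (intro image_mset_cong) (auto simp: S'_def hf)
    finally show ?thesis using a A.S_eq[OF a(1)] by (simp add: S'_def hf)
  qed
  then have "rooted G' (f r) par' dep' S'" by unfold_locales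
  moreover have "S' (f r) = t" using t A.root_in by (simp add: S'_def hf)
  ultimately show ?thesis using B.root_in unfolding rooting_def by blast
qed

text \<open>Moving the root to its child \<open>w\<close> changes the parent of \<open>r\<close>
  only. Vertices below \<open>w\<close> rise by one level, all others sink by one, and shapes change
  only at \<open>r\<close> and \<open>w\<close>.\<close>

lemma rooting_rotate:
  assumes "rooting G r (Node (add_mset (Node Y) X))"
  shows "\<exists>w\<in>verts G. rooting G w (Node (add_mset (Node X) Y))"
proof -
  obtain par dep S where "rooted G r par dep S" and t: "S r = Node (add_mset (Node Y) X)"
    using assms unfolding rooting_def by blast
  interpret A: rooted G r par dep S by fact
  have "image_mset S (mset_set (A.ch r)) = add_mset (Node Y) X" using A.S_eq[OF A.root_in] t by simp
  then have "Node Y \<in># image_mset S (mset_set (A.ch r))" by (simp only: union_single_eq_member)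
  then obtain w where w: "w \<in> A.ch r" "S w = Node Y" by auto
  have wG: "w \<in> verts G" "w \<noteq> r" "par w = r" using w(1) by (auto simp: A.ch_def)
  define par' where "par' = par(r := w)"
  define dep' where "dep' v = (if v \<in> A.desc w then dep v - 1 else Suc (dep v))" for v
  have r_notin: "r \<notin> A.desc w" using A.self_notin_desc_ch[OF w(1)] .
  have dep_w: "dep w = 1" using A.dep_par[OF wG(1,2)] wG A.dep_root by simp
  have in_desc: "par v \<in> A.desc w \<longleftrightarrow> v \<in> A.desc w" if "v \<in> verts G" "v \<noteq> r" "v \<noteq> w" for v
  proof
    show "v \<in> A.desc w" if "par v \<in> A.desc w"
      using that \<open>v \<in> verts G\<close> \<open>v \<noteq> r\<close> by (auto simp: A.ch_def intro: A.desc_step)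
    assume "v \<in> A.desc w"
    then show "par v \<in> A.desc w" by (cases rule: A.desc_cases) (use that in auto)
  qed
  have "parented G w par' dep'"
  proof
    show "finite (verts G)" by (rule A.finite_verts)
    show "w \<in> verts G" by (rule wG)
    show "dep' w = 0" by (simp add: dep'_def dep_w)
    show "edges G = (\<lambda>v. {v, par' v}) ` (verts G - {w})"
    proof -
      define W where "W = verts G - {r} - {w}"
      have W: "verts G - {w} = insert r W" "verts G - {r} = insert w W"
        using wG A.root_in by (auto simp: W_def)
      have "(\<lambda>v. {v, par' v}) ` W = (\<lambda>v. {v, par v}) ` W"
        by (intro image_cong) (auto simp: par'_def W_def)
      then show ?thesis using wG by (simp add: A.edges_eq W par'_def insert_commute)
    qed
    fix v assume v: "v \<in> verts G" "v \<noteq> w"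
    show "par' v \<in> verts G" using A.par_in v wG by (auto simp: par'_def)
    show "dep' v = Suc (dep' (par' v))"
    proof (cases "v = r")
      case True
      then show ?thesis using r_notin by (simp add: par'_def dep'_def dep_w A.dep_root)
    next
      case False
      have "dep v \<ge> 2" if "v \<in> A.desc w"
      proof -
        from that have "par v \<in> A.desc w" using in_desc v False by simp
        then show ?thesis using A.dep_desc[of "par v" w] A.dep_par[OF v(1) False] dep_w by simp
      qed
      then show ?thesis using in_desc[OF v(1) False v(2)] A.dep_par[OF v(1) False] False
        by (auto simp: par'_def dep'_def)
    qed
  qed
  then interpret B: parented G w par' dep' .
  define S' where "S' = S(r := Node X, w := Node (add_mset (Node X) Y))"
  have par'_eq: "par' v = (if v = r then w else par v)" for v by (simp add: par'_def)
  have ch_r: "B.ch r = A.ch r - {w}" using wG(1,2)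
    by (auto simp: B.ch_def A.ch_def par'_eq split: if_splits)
  have r_notin_ch: "r \<notin> A.ch v" for v by (simp add: A.ch_def)
  have ch_w: "B.ch w = insert r (A.ch w)" using wG(1,2) A.root_in A.par_neq[OF wG(1,2)]
    by (auto simp: B.ch_def A.ch_def par'_eq split: if_splits)
  have ch_v: "B.ch v = A.ch v" if "v \<noteq> r" "v \<noteq> w" for v
  proof -
    have "par w \<noteq> v" using wG(3) that(1) by simp
    then show ?thesis using that wG(1,2) by (auto simp: B.ch_def A.ch_def par'_eq split: if_splits)
  qed
  have S'_eq: "image_mset S' (mset_set C) = image_mset S (mset_set C)" if "finite C" "r \<notin> C" "w \<notin> C"
    for C
    using that by (intro image_mset_cong) (auto simp: S'_def)
  have w_notin: "w \<notin> A.ch v" if "v \<noteq> r" for v using wG that by (auto simp: A.ch_def)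
  have "S' v = Node (image_mset S' (mset_set (B.ch v)))" if v: "v \<in> verts G" for v
  proof -
    consider "v = r" | "v = w" | "v \<noteq> r" "v \<noteq> w" by blast
    then show ?thesis
    proof cases
      case 1
      have "mset_set (A.ch r) = add_mset w (mset_set (A.ch r - {w}))"
        using w(1) mset_set.remove[of "A.ch r" w] by simp
      then have "add_mset (Node Y) X = add_mset (Node Y) (image_mset S (mset_set (A.ch r - {w})))"
        using A.S_eq[OF A.root_in] t w(2) by simp
      then show ?thesis using 1 wG r_notin_ch by (simp add: ch_r S'_eq) (simp add: S'_def)
    next
      case 2
      have "S' r = Node X" using wG by (simp add: S'_def)
      then show ?thesis using 2 A.S_eq[OF wG(1)] w(2) wG r_notin_ch[of w] w_notin[of w]
        by (simp add: ch_w S'_eq) (simp add: S'_def)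
    next
      case 3
      then show ?thesis using A.S_eq[OF v] r_notin_ch w_notin
        by (simp add: ch_v S'_eq) (simp add: S'_def)
    qed
  qed
  then have "rooted G w par' dep' S'" by unfold_locales
  moreover have "S' w = Node (add_mset (Node X) Y)" by (simp add: S'_def)
  ultimately show ?thesis using wG unfolding rooting_def by blast
qed

section \<open>The Laplacian determinant of a rooted tree\<close>

lemma (in rooted) wt_S: "v \<in> verts G \<Longrightarrow> wt x (S v) = (\<Prod>w\<in>desc v. x + tau x (S w))"
proof (induction rule: tree_induct)
  case (step v)
  have "wt x (S v) = (x + tau x (S v)) * (\<Prod>c\<in>ch v. wt x (S c))"
    using S_eq[OF step(1)] by (simp add: image_mset.compositionality comp_def prod_unfold_prod_mset)
  also have "(\<Prod>c\<in>ch v. wt x (S c)) = (\<Prod>c\<in>ch v. \<Prod>w\<in>desc c. x + tau x (S w))"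
    using step(2) by (intro prod.cong) auto
  also have "\<dots> = (\<Prod>w\<in>(\<Union>c\<in>ch v. desc c). x + tau x (S w))"
    using finite_desc ch_in desc_disjoint by (intro prod.UNION_disjoint[symmetric]) auto
  also have "(x + tau x (S v)) * \<dots> = (\<Prod>w\<in>insert v (\<Union>c\<in>ch v. desc c). x + tau x (S w))"
    using finite_desc ch_in self_notin_desc_ch by (intro prod.insert[symmetric]) auto
  finally show ?case using desc_eq[of v] by simp
qed

lemma (in rooted) phi0_S_root: "phi0 x (S r) = (\<Prod>v\<in>verts G - {r}. x + tau x (S v))"
proof -
  have "phi0 x (S r) = (\<Prod>c\<in>ch r. wt x (S c))"
    using S_eq[OF root_in] by (simp add: phi0_def image_mset.compositionality comp_def
      prod_unfold_prod_mset)
  also have "\<dots> = (\<Prod>c\<in>ch r. \<Prod>w\<in>desc c. x + tau x (S w))"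
    using wt_S[OF ch_in] by (intro prod.cong) auto
  also have "\<dots> = (\<Prod>w\<in>(\<Union>c\<in>ch r. desc c). x + tau x (S w))"
    using finite_desc ch_in desc_disjoint by (intro prod.UNION_disjoint[symmetric]) auto
  also have "(\<Union>c\<in>ch r. desc c) = verts G - {r}"
    using desc_eq[of r] desc_root self_notin_desc_ch[of _ r] by auto
  finally show ?thesis .
qed

text \<open>A permutation that sends every vertex to itself or to its parent never increases the depth, and it
  preserves the sum of all depths, so it is the identity.\<close>

lemma (in parented) det_parent_matrix:
  fixes B :: "'b :: comm_ring_1 mat" and f :: "nat \<Rightarrow> 'a"
  assumes B: "B \<in> carrier_mat n n" and f: "bij_betw f {0..<n} (verts G)"
    and zero: "\<And>i j. i < n \<Longrightarrow> j < n \<Longrightarrow> j \<noteq> i \<Longrightarrow> \<not> (f i \<noteq> r \<and> f j = par (f i)) \<Longrightarrow> B $$ (i, j) = 0"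
  shows "det B = (\<Prod>i = 0..<n. B $$ (i, i))"
proof -
  have fV: "f i \<in> verts G" if "i < n" for i using f that by (auto dest: bij_betwE)
  have "(\<Prod>i = 0..<n. B $$ (i, p i)) = 0" if p: "p permutes {0..<n}" "p \<noteq> id" for p
  proof (rule ccontr)
    assume "(\<Prod>i = 0..<n. B $$ (i, p i)) \<noteq> 0"
    then have nz: "B $$ (i, p i) \<noteq> 0" if "i < n" for i
      using that prod_zero[of "{0..<n}" "\<lambda>i. B $$ (i, p i)"]
        by (meson atLeastLessThan_iff finite_atLeastLessThan zero_le)
    have pn: "p i < n" if "i < n" for i using permutes_in_image[OF p(1), of i] that by simp
    have c: "p i = i \<or> (f i \<noteq> r \<and> f (p i) = par (f i))" if "i < n" for i
      using zero[OF that pn[OF that]] nz[OF that] by blast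
    have le: "dep (f (p i)) \<le> dep (f i)" if "i < n" for i
      using c[OF that] dep_par[OF fV[OF that]] by auto
    have "(\<Sum>i = 0..<n. dep (f (p i))) = (\<Sum>i = 0..<n. dep (f i))"
      using sum.permute[OF p(1), of "\<lambda>i. dep (f i)"] by (simp add: comp_def)
    then have eq: "dep (f (p i)) = dep (f i)" if "i < n" for i
      using sum_mono_inv[of "\<lambda>i. dep (f (p i))" "{0..<n}" "\<lambda>i. dep (f i)"] le that by auto
    have "p i = i" for i
    proof (cases "i < n")
      case True
      show ?thesis using c[OF True] eq[OF True] dep_par[OF fV[OF True]] by auto
    next
      case False
      then show ?thesis using p(1) by (simp add: permutes_not_in)
    qed
    then show False using p(2) by (simp add: fun_eq_iff)
  qed
  then have "(\<Sum>p | p permutes {0..<n}. signof p * (\<Prod>i = 0..<n. B $$ (i, p i))) =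
      (\<Sum>p\<in>{id}. signof p * (\<Prod>i = 0..<n. B $$ (i, p i)))"
    by (intro sum.mono_neutral_right) (auto simp: finite_permutations permutes_id)
  then show ?thesis by (simp add: det_def'[OF B])
qed

text \<open>Eliminating the leaves first factors the matrix as \<open>N\<^sup>T D N\<close>, where \<open>D\<close> is diagonal with the pivots
  \<open>a v\<close> and \<open>N\<close> has units on the diagonal and \<open>- x / a v\<close> from \<open>v\<close> to its parent.\<close>

lemma (in rooted) det_laplacian:
  fixes f :: "nat \<Rightarrow> 'a"
  assumes x: "x > 0" and f: "bij_betw f {0..<n} (verts G)"
  shows "det (mat n n (\<lambda>(i, j). (if i = j then 1 + x * real (vdegree G (f i)) else 0) -
      (if {f i, f j} \<in> edges G then x else 0))) = phi x (S r)"
proof -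
  \<comment> \<open>The root has no parent edge, so its pivot lacks the summand
    \<open>x\<close>.\<close>
  define a where "a v = (if v = r then tau x (S v) else x + tau x (S v))" for v
  have a_pos: "a v > 0" for v using x tau_pos[OF x, of "S v"]
    by (cases "v = r") (simp_all add: a_def)
  define N where "N i j = (if i = j then 1 else 0) - (if f i \<in> ch (f j) then x / a (f i) else 0)"
    for i j
  have fV: "f i \<in> verts G" if "i < n" for i using f that by (auto dest: bij_betwE)
  have f_eq: "f i = f j \<longleftrightarrow> i = j" if "i < n" "j < n" for i j
    using f that by (auto simp: bij_betw_def dest: inj_onD)
  have irrefl: "v \<notin> ch v" for v using dep_ch[of v v] by auto
  define A B where "A = mat n n (\<lambda>(i, j). N i j)" and "B = mat n n (\<lambda>(i, j). a (f i) * N i j)"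
  have car: "A \<in> carrier_mat n n" "B \<in> carrier_mat n n" by (auto simp: A_def B_def)
  have detA: "det A = 1"
  proof -
    have "det A = (\<Prod>i = 0..<n. A $$ (i, i))"
      by (rule det_parent_matrix[OF car(1) f]) (auto simp: A_def N_def ch_def)
    also have "\<dots> = 1" by (intro prod.neutral) (auto simp: A_def N_def irrefl)
    finally show ?thesis .
  qed
  have detB: "det B = phi x (S r)"
  proof -
    have "det B = (\<Prod>i = 0..<n. B $$ (i, i))"
      by (rule det_parent_matrix[OF car(2) f]) (auto simp: B_def N_def ch_def)
    also have "\<dots> = (\<Prod>i = 0..<n. a (f i))" by (intro prod.cong) (auto simp: B_def N_def irrefl)
    also have "\<dots> = (\<Prod>v\<in>verts G. a v)" by (rule prod.reindex_bij_betw[OF f])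
    also have "\<dots> = a r * (\<Prod>v\<in>verts G - {r}. a v)" using finite_verts root_in by (rule prod.remove)
    also have "(\<Prod>v\<in>verts G - {r}. a v) = phi0 x (S r)" unfolding phi0_S_root
      by (intro prod.cong) (auto simp: a_def)
    finally show ?thesis by (simp add: phi_def a_def)
  qed
  \<comment> \<open>A child contributes \<open>x\<close> through the degree of \<open>v\<close> and
    loses \<open>x\<^sup>2 / a u\<close> when it is eliminated; the difference is the series
    conductance.\<close>
  have tau_S: "tau x (S v) = 1 + (\<Sum>u\<in>ch v. x - x\<^sup>2 / a u)" if v: "v \<in> verts G" for v
  proof -
    have "tau x (S v) = 1 + (\<Sum>u\<in>ch v. series x (tau x (S u)))"
      using S_eq[OF v] by (simp add: branch_sum_def image_mset.compositionality comp_def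
        sum_unfold_sum_mset)
    also have "(\<Sum>u\<in>ch v. series x (tau x (S u))) = (\<Sum>u\<in>ch v. x - x\<^sup>2 / a u)"
    proof (rule sum.cong)
      fix u assume "u \<in> ch v"
      then have "a u = x + tau x (S u)" by (simp add: a_def ch_def)
      moreover have "x + tau x (S u) > 0" using x tau_pos[OF x, of "S u"] by simp
      ultimately show "series x (tau x (S u)) = x - x\<^sup>2 / a u"
        by (simp add: series_def field_simps power2_eq_square)
    qed simp
    finally show ?thesis .
  qed
  have diag: "a v + (\<Sum>u\<in>ch v. x\<^sup>2 / a u) = 1 + x * real (vdegree G v)" if v: "v \<in> verts G" for v
  proof -
    have "tau x (S v) + (\<Sum>u\<in>ch v. x\<^sup>2 / a u) = 1 + x * real (card (ch v))"
      using tau_S[OF v] by (simp add: sum_subtractf)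
    moreover have "a v = (if v = r then tau x (S v) else x + tau x (S v))" by (simp add: a_def)
    ultimately show ?thesis by (auto simp: vdegree_eq[OF v] algebra_simps)
  qed
  have entry: "(\<Sum>i = 0..<n. N i j * (a (f i) * N i k)) =
     (if j = k then 1 + x * real (vdegree G (f j)) else 0) - (if {f j, f k} \<in> edges G then x else
       0)"
    if j: "j < n" and k: "k < n" for j k
  proof -
    define u w where "u = f j" and "w = f k"
    have uw: "u \<in> verts G" "w \<in> verts G" "u = w \<longleftrightarrow> j = k" using fV j k f_eq
      by (auto simp: u_def w_def)
    define M where "M v w = (if v = w then 1 else 0) - (if v \<in> ch w then x / a v else 0)" for v w
    have "(\<Sum>i = 0..<n. N i j * (a (f i) * N i k)) = (\<Sum>i = 0..<n. M (f i) u * (a (f i) * M (f i) w))"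
      by (intro sum.cong) (auto simp: N_def M_def u_def w_def f_eq j k)
    also have "\<dots> = (\<Sum>v\<in>verts G. M v u * (a v * M v w))"
      by (rule sum.reindex_bij_betw[OF f])
    \<comment> \<open>A summand survives only if \<open>v\<close> is \<open>u\<close> or its child
      and also \<open>w\<close> or its child. For a common child \<open>v\<close>, uniqueness of the
      parent forces \<open>u = w\<close>.\<close>
    also have "\<dots> = (\<Sum>v\<in>verts G. (if v = u then if u = w then a u else 0 else 0)
         - (if v = u then if u \<in> ch w then x else 0 else 0) - (if v = w then
           if w \<in> ch u then x else 0 else 0)
         + (if v \<in> ch u then if u = w then x\<^sup>2 / a v else 0 else 0))"
    proof (rule sum.cong)
      fix v assume "v \<in> verts G"
      have "a v \<noteq> 0" using a_pos[of v] by simp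
      moreover have "v \<in> ch u \<Longrightarrow> v \<in> ch w \<Longrightarrow> u = w" by (simp add: ch_def)
      ultimately show "M v u * (a v * M v w) = (if v = u then if u = w then a u else 0 else 0)
         - (if v = u then if u \<in> ch w then x else 0 else 0) - (if v = w then
           if w \<in> ch u then x else 0 else 0)
         + (if v \<in> ch u then if u = w then x\<^sup>2 / a v else 0 else 0)"
        using irrefl[of u] irrefl[of w] by (auto simp: M_def power2_eq_square)
    qed simp
    also have "\<dots> = (if u = w then a u else 0) - (if u \<in> ch w then x else 0) - (if w \<in> ch u then x
      else 0)
        + (if u = w then \<Sum>v\<in>ch u. x\<^sup>2 / a v else 0)"
    proof -
      have "(\<Sum>v\<in>verts G. if v \<in> ch u then if u = w then x\<^sup>2 / a v else 0 else 0) = (\<Sum>v\<in>ch u. if u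
        = w then x\<^sup>2 / a v else 0)"
        using finite_verts ch_subset[of u] by (simp add: sum.inter_restrict[symmetric] Int_absorb1)
      then show ?thesis using finite_verts uw by (simp add: sum.distrib sum_subtractf sum.delta)
    qed
    also have "\<dots> = (if u = w then 1 + x * real (vdegree G u) else 0) - (if {u, w} \<in> edges G then x
      else 0)"
      using diag[OF uw(1)] irrefl[of u] dep_ch[of u w] dep_ch[of w u] by (auto simp: edge_iff)
    finally show ?thesis using uw(3) by (simp add: u_def w_def)
  qed
  have "mat n n (\<lambda>(i, j). (if i = j then 1 + x * real (vdegree G (f i)) else 0) -
      (if {f i, f j} \<in> edges G then x else 0)) = transpose_mat A * B"
    by (rule eq_matI) (auto simp: scalar_prod_def A_def B_def entry)
  then show ?thesis using car detA detB by (simp add: det_mult[of _ n] det_transpose[of _ n])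
qed

text \<open>At \<lambda> = -1/x the matrix \<lambda> I - A equals -1/x times I + x A. Multiplying by
  the n-th power of -x reverses the order of the coefficients.\<close>

lemma char_poly_reverse:
  fixes A :: "real mat"
  assumes A: "A \<in> carrier_mat n n" and x: "x > 0"
  shows "(\<Sum>k\<le>n. (-1) ^ k * coeff (char_poly A) (n - k) * x ^ k) = det (1\<^sub>m n + x \<cdot>\<^sub>m A)"
proof -
  have deg: "degree (char_poly A) = n" using degree_monic_char_poly[OF A] by simp
  have "poly (char_poly A) (- 1 / x) = det ((- 1 / x) \<cdot>\<^sub>m (1\<^sub>m n + x \<cdot>\<^sub>m A))"
    unfolding char_poly_matrix[OF A]
    by (rule arg_cong[of _ _ det], rule eq_matI) (use A x in \<open>auto simp: char_matrix_def
      field_simps\<close>)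
  also have "\<dots> = (- 1 / x) ^ n * det (1\<^sub>m n + x \<cdot>\<^sub>m A)" using A by simp
  finally have p: "poly (char_poly A) (- 1 / x) = (- 1 / x) ^ n * det (1\<^sub>m n + x \<cdot>\<^sub>m A)" .
  have "(\<Sum>k\<le>n. (-1) ^ k * coeff (char_poly A) (n - k) * x ^ k) =
      (\<Sum>i\<le>n. (- x) ^ (n - i) * coeff (char_poly A) i)"
    by (rule sum.reindex_bij_witness[of _ "\<lambda>i. n - i" "\<lambda>k. n - k"]) (auto simp: power_minus[of x])
  also have "\<dots> = (\<Sum>i\<le>n. (- x) ^ n * (coeff (char_poly A) i * (- 1 / x) ^ i))"
  proof (rule sum.cong)
    fix i assume "i \<in> {..n}"
    then have "(- x) ^ n = (- x) ^ (n - i) * (- x) ^ i" by (simp add: power_add[symmetric])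
    moreover have "(- x) ^ i * (- 1 / x) ^ i = 1" using x
      by (simp add: power_mult_distrib[symmetric])
    ultimately show "(- x) ^ (n - i) * coeff (char_poly A) i
      = (- x) ^ n * (coeff (char_poly A) i * (- 1 / x) ^ i)"
      by (simp add: mult.assoc mult.left_commute)
  qed simp
  also have "\<dots> = (- x) ^ n * poly (char_poly A) (- 1 / x)"
    by (simp add: poly_altdef deg sum_distrib_left)
  also have "\<dots> = det (1\<^sub>m n + x \<cdot>\<^sub>m A)"
    unfolding p using x by (simp add: mult.assoc[symmetric] power_mult_distrib[symmetric])
  finally show ?thesis .
qed

lemma laplacian_carrier: "laplacian_matrix G \<in> carrier_mat (order G) (order G)"
  unfolding laplacian_matrix_def by (rule minus_carrier_mat) (simp add: adjacency_matrix_def)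

text \<open>The all-ones vector lies in the kernel. This bridges a difference of one summand:
  \<open>laplacian_gen\<close> stops at \<open>n - 1\<close>, whereas the determinant expansion runs
  to \<open>n\<close>.\<close>

lemma laplacian_singular:
  assumes G: "simple_graph G" and V: "verts G = {0..<n}" and n: "n > 0"
  shows "coeff (char_poly (laplacian_matrix G)) 0 = 0"
proof -
  have ord: "order G = n" by (simp add: order_def V)
  have L: "laplacian_matrix G \<in> carrier_mat n n"
    using laplacian_carrier[of G] by (simp add: ord)
  have "laplacian_matrix G *\<^sub>v vec n (\<lambda>_. 1) = 0 \<cdot>\<^sub>v vec n (\<lambda>_. 1)"
  proof (rule eq_vecI)
    fix i assume "i < dim_vec (0 \<cdot>\<^sub>v vec n (\<lambda>_. 1 :: real))"
    then have i: "i < n" by simp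
    have "(laplacian_matrix G *\<^sub>v vec n (\<lambda>_. 1)) $ i =
        (\<Sum>j = 0..<n. (if i = j then real (vdegree G i) else 0) - (if {i, j} \<in> edges G then 1 else
          0))"
      using i L by (simp add: scalar_prod_def laplacian_matrix_def degree_matrix_def
        adjacency_matrix_def ord)
    also have "\<dots> = real (vdegree G i) - (\<Sum>j = 0..<n. if {i, j} \<in> edges G then 1 else 0)"
      using i by (simp add: sum_subtractf)
    also have "(\<Sum>j = 0..<n. if {i, j} \<in> edges G then 1 else 0) = real (vdegree G i)"
      by (simp add: vdegree_def neighbours_def V insert_commute sum.inter_filter[symmetric])
    finally show "(laplacian_matrix G *\<^sub>v vec n (\<lambda>_. 1)) $ i = (0 \<cdot>\<^sub>v vec n (\<lambda>_. 1)) $ i" using i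
      by simp
  qed (use L in simp)
  moreover have "vec n (\<lambda>_. 1 :: real) \<noteq> 0\<^sub>v n"
  proof
    assume "vec n (\<lambda>_. 1 :: real) = 0\<^sub>v n"
    then have "vec n (\<lambda>_. 1 :: real) $ 0 = 0\<^sub>v n $ 0" by simp
    then show False using n by simp
  qed
  ultimately have "eigenvalue (laplacian_matrix G) 0"
    using L unfolding eigenvalue_def eigenvector_def by (intro exI[of _ "vec n (\<lambda>_. 1)"]) auto
  then show ?thesis using eigenvalue_root_char_poly[OF L] by (simp add: poly_0_coeff_0)
qed

lemma laplacian_gen_rooting:
  assumes "rooting G r t" and V: "verts G = {0..<n}" and x: "x > 0"
  shows "laplacian_gen G x = phi x t"
proof -
  obtain par dep S where "rooted G r par dep S" and t: "S r = t" using assms(1)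
    unfolding rooting_def by blast
  interpret rooted G r par dep S by fact
  have ord: "order G = n" by (simp add: order_def V)
  have L: "laplacian_matrix G \<in> carrier_mat n n"
    using laplacian_carrier[of G] by (simp add: ord)
  have n: "n > 0" using root_in V by auto
  have "laplacian_gen G x = (\<Sum>k\<le>n. (-1) ^ k * coeff (char_poly (laplacian_matrix G)) (n - k) * x ^
    k)"
    unfolding laplacian_gen_def laplacian_coeff_def ord lessThan_Suc_atMost[symmetric]
    using laplacian_singular[OF simple_G V n] by simp
  also have "\<dots> = det (1\<^sub>m n + x \<cdot>\<^sub>m laplacian_matrix G)" by (rule char_poly_reverse[OF L x])
  also have "1\<^sub>m n + x \<cdot>\<^sub>m laplacian_matrix G = mat n n (\<lambda>(i, j). (if i = j then 1
    + x * real (vdegree G (id i)) else 0) -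
      (if {id i, id j} \<in> edges G then x else 0))"
    by (rule eq_matI) (auto simp: laplacian_matrix_def degree_matrix_def adjacency_matrix_def ord
      algebra_simps)
  also have "det \<dots> = phi x (S r)" by (rule det_laplacian[OF x]) (simp add: V bij_betw_def)
  finally show ?thesis using t by simp
qed

section \<open>Return to labelled trees\<close>

lemma in_trees_max_degree:
  assumes T: "T \<in> trees_max_degree n (d + 1)" and rt: "rooting T r t"
  shows "admissible d t" "nodes t = n"
proof -
  obtain par dep S where "rooted T r par dep S" and t: "S r = t" using rt unfolding rooting_def
    by blast
  interpret rooted T r par dep S by fact
  have V: "verts T = {0..<n}" and md: "max_degree T = d + 1" using T
    by (auto simp: trees_max_degree_def)
  have "vdegree T v \<le> d + 1" if v: "v \<in> verts T" for v
    unfolding md[symmetric] max_degree_def by (rule Max_ge) (use finite_verts v in auto)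
  then show "admissible d t" using admissible_S t by simp
  show "nodes t = n" using nodes_S[OF root_in] t by (simp add: desc_root V)
qed

lemma trees_max_degree_order:
  assumes "T \<in> trees_max_degree n (d + 1)"
  shows "n \<ge> d + 2"
proof -
  have V: "verts T = {0..<n}" and T: "tree T" and md: "max_degree T = d + 1"
    using assms by (auto simp: trees_max_degree_def)
  have "verts T \<noteq> {}" using T by (simp add: tree_def connected_graph_def)
  then have "d + 1 \<in> vdegree T ` verts T"
    unfolding md[symmetric] max_degree_def by (intro Max_in) (use V in auto)
  then obtain v where v: "v \<in> verts T" "vdegree T v = d + 1" by auto
  have "{v, v} \<notin> edges T"
    using T unfolding tree_def simple_graph_def by fastforce
  then have "neighbours T v \<subseteq> {0..<n} - {v}" unfolding neighbours_def V by blast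
  then have "card (neighbours T v) \<le> card ({0..<n} - {v})" by (intro card_mono) auto
  then show ?thesis using v V by (simp add: vdegree_def)
qed

text \<open>Serves the equality case, where the tree is given and only its root may be chosen. A
  root of largest conductance is taken among the rootings of \<open>T\<close>, and
  \<open>rooting_rotate\<close> shows that the neighbouring roots compete.\<close>

lemma optimal_tree_rooting:
  assumes x: "x > 0" and d: "0 < d" and T: "T \<in> trees_max_degree n (d + 1)"
    and r0: "rooting T r0 t0" and opt0: "optimal d x t0"
  shows "\<exists>r t. rooting T r t \<and> greedy_shape d t"
proof -
  define A where "A = {t. (\<exists>r. rooting T r t) \<and> optimal d x t}"
  have nodes: "nodes t = n" if "t \<in> A" for t using in_trees_max_degree(2)[OF T] that
    by (auto simp: A_def)
  have "finite A" by (rule finite_subset[OF _ finite_nodes_le[of n]]) (use nodes in auto)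
  moreover have "A \<noteq> {}" using r0 opt0 by (auto simp: A_def)
  ultimately obtain t where t: "t \<in> A" "\<And>t'. t' \<in> A \<Longrightarrow> tau x t' \<le> tau x t"
    using arg_min_if_finite[of A "\<lambda>t. - tau x t"] by (metis neg_less_iff_less not_le)
  obtain r where r: "rooting T r t" and opt: "optimal d x t" using t(1) by (auto simp: A_def)
  have "greedy_shape d t"
  proof (rule optimal_greedy_shape[OF x d opt])
    show "d + 2 \<le> nodes t" using trees_max_degree_order[OF T] nodes[OF t(1)] by simp
    fix X Y assume e: "t = Node (add_mset (Node Y) X)"
    have "optimal d x (Node (add_mset (Node X) Y))" using optimal_rotate[OF x opt[unfolded e]] ..
    moreover have "\<exists>r. rooting T r (Node (add_mset (Node X) Y))"
      using rooting_rotate[OF r[unfolded e]] by blast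
    ultimately show "tau x (Node (add_mset (Node X) Y)) \<le> tau x t" by (intro t(2)) (simp add: A_def)
  qed
  then show ?thesis using r by blast
qed

lemma greedy_rooting:
  assumes d: "0 < d" and G: "greedy_tree d G"
  shows "\<exists>r t. rooting G r t \<and> greedy_shape d t"
proof -
  obtain r where r: "greedy_rooted_tree d G r" using G by (auto simp: greedy_tree_def)
  then have "tree G" "r \<in> verts G" by (auto simp: greedy_rooted_tree_def)
  from ex_rooting[OF this] obtain t where t: "rooting G r t" ..
  then obtain par dep S where "rooted G r par dep S" and S: "S r = t" unfolding rooting_def by blast
  interpret rooted G r par dep S by fact
  have "greedy_shape d t" using greedy_iff[OF d] r S by simp
  then show ?thesis using t by blast
qed

lemma ex_greedy_tree:
  assumes d: "0 < d" and n: "n \<ge> d + 2"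
  shows "\<exists>G \<in> trees_max_degree n (d + 1). greedy_tree d G"
proof -
  \<comment> \<open>The greedy shape is obtained as a minimiser for the arbitrary value
    \<open>x = 1\<close> instead of being constructed.\<close>
  obtain t where t: "nodes t = n" "greedy_shape d t"
    using ex_optimal_greedy_shape[of 1, OF _ d n] by auto
  have "card {0..<n} = nodes t" "0 \<in> {0..<n}" using t n by auto
  from realise[OF finite_atLeastLessThan this]
  obtain E par dep S where "rooted ({0..<n}, E) 0 par dep S" and S: "S 0 = t" by blast
  interpret rooted "({0..<n}, E)" 0 par dep S by fact
  have g: "greedy_rooted_tree d ({0..<n}, E) 0" using greedy_iff[OF d] S t(2) by simp
  then have "({0..<n}, E) \<in> trees_max_degree n (d + 1)"
    by (simp add: trees_max_degree_def greedy_rooted_tree_def)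
  then show ?thesis using g by (auto simp: greedy_tree_def)
qed

text \<open>The first conjunct keeps the second from being vacuous; by
  \<open>trees_max_degree_order\<close> the class is empty for smaller \<open>n\<close>. The
  equality clause is stated for each \<open>x\<close> separately, so equality at one positive
  \<open>x\<close> already gives an isomorphism.\<close>

theorem theorem1p3:
  fixes d n :: nat
  assumes "d \<ge> 1"
  shows "(n \<ge> d + 2 \<longrightarrow> (\<exists>G \<in> trees_max_degree n (d + 1). greedy_tree d G)) \<and>
    (\<forall>G \<in> trees_max_degree n (d + 1). greedy_tree d G \<longrightarrow>
      (\<forall>T \<in> trees_max_degree n (d + 1). \<forall>x::real. x > 0 \<longrightarrow>
         laplacian_gen G x \<le> laplacian_gen T x \<and>
         (laplacian_gen G x = laplacian_gen T x \<longleftrightarrow> graph_iso T G)))"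
proof (rule conjI; intro impI ballI allI)
  have d: "0 < d" using assms by simp
  show "\<exists>G \<in> trees_max_degree n (d + 1). greedy_tree d G" if "n \<ge> d + 2"
    using ex_greedy_tree[OF d that] .
  fix G T :: "nat ugraph" and x :: real
  assume G: "G \<in> trees_max_degree n (d + 1)" and g: "greedy_tree d G"
    and T: "T \<in> trees_max_degree n (d + 1)" and x: "x > 0"
  have V: "verts G = {0..<n}" "verts T = {0..<n}" and tree: "tree G" "tree T"
    using G T by (auto simp: trees_max_degree_def)
  obtain r t where t: "rooting G r t" "greedy_shape d t" using greedy_rooting[OF d g] by blast
  have "verts T \<noteq> {}" using tree(2) by (simp add: tree_def connected_graph_def)
  then obtain r' where "r' \<in> verts T" by blast
  from ex_rooting[OF tree(2) this] obtain t' where t': "rooting T r' t'" ..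
  note adm = in_trees_max_degree[OF G t(1)] in_trees_max_degree[OF T t']
  have opt: "optimal d x t"
    using greedy_shape_optimal[OF x d t(2)] trees_max_degree_order[OF G] adm(2) by simp
  have gen: "laplacian_gen G x = phi x t" "laplacian_gen T x = phi x t'"
    using laplacian_gen_rooting[OF t(1) V(1) x] laplacian_gen_rooting[OF t' V(2) x] .
  have "graph_iso T G" if eq: "phi x t = phi x t'"
  proof -
    \<comment> \<open>Equality makes \<open>T\<close> a minimiser, but \<open>r'\<close> was
      arbitrary; \<open>T\<close> is re-rooted before its shape is compared with that of
      \<open>G\<close>.\<close>
    have "optimal d x t'" using opt adm eq by (simp add: optimal_def)
    then obtain r2 t2 where t2: "rooting T r2 t2" "greedy_shape d t2"
      using optimal_tree_rooting[OF x d T t'] by blast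
    have "nodes t2 = nodes t" using in_trees_max_degree(2)[OF T t2(1)] adm(2) by simp
    then have "t2 = t" by (rule greedy_shape_unique[OF d t2(2) t(2)])
    then show ?thesis using rooting_iso[OF t2(1), of G r] t(1) by simp
  qed
  moreover have "phi x t = phi x t'" if iso: "graph_iso T G"
  proof -
    have "simple_graph G" using tree(1) by (simp add: tree_def)
    then obtain r2 where "rooting G r2 t'" using rooting_transport[OF iso _ t'] by blast
    then show ?thesis using laplacian_gen_rooting[OF _ V(1) x] gen(1) by simp
  qed
  moreover have "phi x t \<le> phi x t'" using opt adm unfolding optimal_def by simp
  ultimately show "laplacian_gen G x \<le> laplacian_gen T x \<and>
      (laplacian_gen G x = laplacian_gen T x \<longleftrightarrow> graph_iso T G)"
    unfolding gen by blast
qed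

end
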